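(* Let $\mathcal{J}:\mathfrak{g}_2\to\mathfrak{g}_2$ be the Samelson complex structure on $\mathfrak{g}_2=\mathrm{Lie}(G_2)$ defined in the context, let $\lambda_0,\lambda_1,\dots,\lambda_6$ be positive real numbers, let $\widehat{g}$ be the associated Hermitian inner product on $(\mathfrak{g}_2)_{\mathbb{C}}$ defined in the context, and let $g:=\widehat{g}|_{\mathfrak{g}_2\times\mathfrak{g}_2}$ be the positive definite inner product on $\mathfrak{g}_2$ induced by $\widehat{g}$. Then $g(\mathcal{J}\cdot,\mathcal{J}\cdot)=g(\cdot,\cdot)$. In particular, $(g,\mathcal{J})$ determines a left-invariant Hermitian structure on $G_2$ (whose Hermitian metric depends on the seven positive parameters $\lambda_0,\dots,\lambda_6$).
   Context: **The group.** Let $e^1,\dots,e^7$ be the dual of the standard basis of $\mathbb{R}^7$, $e^{ijk}:=e^i\wedge e^j\wedge e^k$, and $\phi:=e^{147}+e^{257}+e^{367}+e^{123}-e^{156}+e^{246}-e^{345}$. $G_2$ is the Lie group of linear maps $F:\mathbb{R}^7\to\mathbb{R}^7$ with $F^*\phi=\phi$; it is a compact Lie subgroup of $SO(7)$. Its Lie algebra $\mathfrak{g}_2\subset\mathfrak{so}(7)$ is 14-dimensional. Let $E_{ij}$ ($i<j$) be the $7\times7$ matrix with $(i,j)$-entry $1$, $(j,i)$-entry $-1$ and all other entries $0$. A basis of $\mathfrak{g}_2$ is $b_1=E_{12}-E_{67}$, $b_2=E_{13}+E_{46}$, $b_3=E_{17}-E_{26}$, $b_4=E_{23}-E_{47}$,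 $b_5=E_{24}+E_{15}$, $b_6=E_{25}-E_{14}$, $b_7=E_{27}+E_{16}$, $b_8=E_{34}+E_{16}$, $b_9=E_{35}+E_{26}$, $b_{10}=E_{36}-E_{14}$, $b_{11}=E_{37}-E_{15}$, $b_{12}=E_{45}+E_{67}$, $b_{13}=E_{56}+E_{47}$, $b_{14}=E_{57}-E_{46}$. **The complex structure.** $\mathcal{J}:\mathfrak{g}_2\to\mathfrak{g}_2$ is the linear map with $\mathcal{J}b_1=-\frac1{\sqrt3}b_1-\frac2{\sqrt3}b_{12}$, $\mathcal{J}b_2=-b_4$, $\mathcal{J}b_3=-b_7$, $\mathcal{J}b_4=b_2$, $\mathcal{J}b_5=-b_6$, $\mathcal{J}b_6=b_5$, $\mathcal{J}b_7=b_3$, $\mathcal{J}b_8=b_3+b_9$, $\mathcal{J}b_9=b_7-b_8$, $\mathcal{J}b_{10}=b_5+b_{11}$, $\mathcal{J}b_{11}=b_6-b_{10}$, $\mathcal{J}b_{12}=\frac2{\sqrt3}b_1+\frac1{\sqrt3}b_{12}$, $\mathcal{J}b_{13}=b_{14}$, $\mathcal{J}b_{14}=-b_{13}$. It satisfies $\mathcal{J}^2=-\mathrm{id}$ and has vanishing Nijenhuis tensor, so by left translation it defines a left-invariant integrable almost complex structure on $G_2$. **The Hermitian inner product $\widehat g$.** In the complexification $(\mathfrak{g}_2)_{\mathbb{C}}$ put $H_1:=b_1$, $H_2:=-\frac1{\sqrt3}b_1-\frac2{\sqrt3}b_{12}$ and $E_{\alpha_1}:=b_5+ib_6$, $E_{\alpha_2}:=b_{14}+ib_{13}$,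 $E_{\alpha_3}:=(2b_2+b_{14})+i(2b_4+b_{13})$, $E_{\alpha_4}:=-(b_5+2b_{11})+i(b_6-2b_{10})$, $E_{\alpha_5}:=b_3+ib_7$, $E_{\alpha_6}:=(b_7-2b_8)+i(b_3+2b_9)$. Then $H_1,H_2,E_{\alpha_1},\dots,E_{\alpha_6},\overline{E}_{\alpha_1},\dots,\overline{E}_{\alpha_6}$ is a basis of $(\mathfrak{g}_2)_{\mathbb{C}}$. For $X=X^1H_1+X^2H_2+\sum_jA^jE_{\alpha_j}+\sum_jB^j\overline{E}_{\alpha_j}$ and $Y=Y^1H_1+Y^2H_2+\sum_jC^jE_{\alpha_j}+\sum_jD^j\overline{E}_{\alpha_j}$ define $$\widehat{g}(X,Y):=\lambda_0(\overline{X^1}Y^1+\overline{X^2}Y^2)+\sum_{j=1}^6\lambda_j(\overline{A^j}C^j+\overline{B^j}D^j).$$ This is a Hermitian inner product ($\mathbb{C}$-linear in the second argument) which is real-valued on $\mathfrak{g}_2\times\mathfrak{g}_2$, so its restriction to $\mathfrak{g}_2$ is a positive definite inner product. **Conventions.** Inner products on $\mathfrak{g}_2$ (the tangent space at the identity) are identified with left-invariant Riemannian metrics on $G_2$. A left-invariant Hermitian structure is a pair consisting of a left-invariant integrable almost complex structure and a left-invariant Riemannian metric preserved by it. *)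

theory Defs
  imports "HOL-Analysis.Analysis"
begin

section \<open>Tensor fields on submanifolds of a Euclidean space\<close>

text \<open>Iterated total differentiability in all directions; intended for open \<^term>\<open>U\<close>.\<close>

primrec Ck_on :: "nat \<Rightarrow> 'a::euclidean_space set \<Rightarrow> ('a \<Rightarrow> 'b::real_normed_vector) \<Rightarrow> bool" where
  "Ck_on 0 U f \<longleftrightarrow> continuous_on U f"
| "Ck_on (Suc k) U f \<longleftrightarrow>
     f differentiable_on U \<and> (\<forall>v. Ck_on k U (\<lambda>x. frechet_derivative f (at x) v))"

definition smooth_on :: "'a::euclidean_space set \<Rightarrow> ('a \<Rightarrow> 'b::real_normed_vector) \<Rightarrow> bool" where
  "smooth_on U f \<longleftrightarrow> open U \<and> (\<forall>k. Ck_on k U f)"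

text \<open>Below, \<^term>\<open>G\<close> stands for a closed embedded submanifold. Tangent vectors are velocities of
  curves in \<^term>\<open>G\<close>, and a function or vector field is smooth on \<^term>\<open>G\<close> iff it is the restriction
  of a smooth map on an open neighbourhood of \<^term>\<open>G\<close>.\<close>

definition tangent_space :: "'a::real_normed_vector set \<Rightarrow> 'a \<Rightarrow> 'a set" where
  "tangent_space G p =
     {v. \<exists>\<gamma> :: real \<Rightarrow> 'a. (\<forall>t. \<gamma> t \<in> G) \<and> \<gamma> 0 = p \<and> (\<gamma> has_vector_derivative v) (at 0)}"

definition smooth_function :: "'a::euclidean_space set \<Rightarrow> ('a \<Rightarrow> real) \<Rightarrow> bool" where
  "smooth_function G f \<longleftrightarrow> (\<exists>U f'. G \<subseteq> U \<and> smooth_on U f' \<and> (\<forall>p\<in>G. f' p = f p))"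

text \<open>A vector field is given together with a smooth extension to a neighbourhood; only its values
  on \<^term>\<open>G\<close> are meaningful.\<close>

definition vector_field :: "'a::euclidean_space set \<Rightarrow> ('a \<Rightarrow> 'a) \<Rightarrow> bool" where
  "vector_field G V \<longleftrightarrow> (\<exists>U. G \<subseteq> U \<and> smooth_on U V) \<and> (\<forall>p\<in>G. V p \<in> tangent_space G p)"

text \<open>On \<^term>\<open>G\<close> this does not depend on the extensions, because each field is differentiated in a
  direction tangent to \<^term>\<open>G\<close>.\<close>

definition lie_bracket :: "('a::euclidean_space \<Rightarrow> 'a) \<Rightarrow> ('a \<Rightarrow> 'a) \<Rightarrow> 'a \<Rightarrow> 'a" where
  "lie_bracket V W p =
     frechet_derivative W (at p) (V p) - frechet_derivative V (at p) (W p)"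

definition almost_complex_structure :: "'a::euclidean_space set \<Rightarrow> ('a \<Rightarrow> 'a \<Rightarrow> 'a) \<Rightarrow> bool" where
  "almost_complex_structure G J \<longleftrightarrow>
     (\<forall>p\<in>G. \<forall>v\<in>tangent_space G p.
        J p v \<in> tangent_space G p \<and> J p (J p v) = - v \<and>
        (\<forall>a. J p (a *\<^sub>R v) = a *\<^sub>R J p v) \<and>
        (\<forall>w\<in>tangent_space G p. J p (v + w) = J p v + J p w)) \<and>
     (\<forall>V. vector_field G V \<longrightarrow> (\<exists>V'. vector_field G V' \<and> (\<forall>p\<in>G. V' p = J p (V p))))"

text \<open>Vanishing of the Nijenhuis tensor; \<^term>\<open>V'\<close> and \<^term>\<open>W'\<close> are the fields \<open>J V\<close> and \<open>J W\<close>
  with arbitrary smooth extensions.\<close>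

definition integrable_structure :: "'a::euclidean_space set \<Rightarrow> ('a \<Rightarrow> 'a \<Rightarrow> 'a) \<Rightarrow> bool" where
  "integrable_structure G J \<longleftrightarrow>
     (\<forall>V W V' W'. vector_field G V \<and> vector_field G W \<and> vector_field G V' \<and> vector_field G W' \<and>
        (\<forall>p\<in>G. V' p = J p (V p) \<and> W' p = J p (W p)) \<longrightarrow>
        (\<forall>p\<in>G. lie_bracket V' W' p - J p (lie_bracket V' W p) - J p (lie_bracket V W' p)
                 - lie_bracket V W p = 0))"

definition riemannian_metric :: "'a::euclidean_space set \<Rightarrow> ('a \<Rightarrow> 'a \<Rightarrow> 'a \<Rightarrow> real) \<Rightarrow> bool" where
  "riemannian_metric G g \<longleftrightarrow>
     (\<forall>p\<in>G. \<forall>v\<in>tangent_space G p.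
        (v \<noteq> 0 \<longrightarrow> g p v v > 0) \<and>
        (\<forall>w\<in>tangent_space G p. g p v w = g p w v \<and>
           (\<forall>a. g p (a *\<^sub>R v) w = a * g p v w) \<and>
           (\<forall>u\<in>tangent_space G p. g p (v + u) w = g p v w + g p u w))) \<and>
     (\<forall>V W. vector_field G V \<and> vector_field G W \<longrightarrow> smooth_function G (\<lambda>p. g p (V p) (W p)))"

section \<open>Left-invariant Hermitian structures on matrix groups\<close>

type_synonym mat7 = "real^7^7"

text \<open>The left translation \<open>X \<mapsto> A ** X\<close> is linear, so it is its own differential.\<close>

definition left_invariant_endo :: "mat7 set \<Rightarrow> (mat7 \<Rightarrow> mat7 \<Rightarrow> mat7) \<Rightarrow> bool" where
  "left_invariant_endo G J \<longleftrightarrow>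
     (\<forall>A\<in>G. \<forall>F\<in>G. \<forall>v\<in>tangent_space G F. J (A ** F) (A ** v) = A ** J F v)"

definition left_invariant_metric :: "mat7 set \<Rightarrow> (mat7 \<Rightarrow> mat7 \<Rightarrow> mat7 \<Rightarrow> real) \<Rightarrow> bool" where
  "left_invariant_metric G g \<longleftrightarrow>
     (\<forall>A\<in>G. \<forall>F\<in>G. \<forall>v\<in>tangent_space G F. \<forall>w\<in>tangent_space G F.
        g (A ** F) (A ** v) (A ** w) = g F v w)"

definition left_invariant_hermitian_structure ::
  "mat7 set \<Rightarrow> (mat7 \<Rightarrow> mat7 \<Rightarrow> mat7) \<Rightarrow> (mat7 \<Rightarrow> mat7 \<Rightarrow> mat7 \<Rightarrow> real) \<Rightarrow> bool" where
  "left_invariant_hermitian_structure G J g \<longleftrightarrow>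
     almost_complex_structure G J \<and> integrable_structure G J \<and> left_invariant_endo G J \<and>
     riemannian_metric G g \<and> left_invariant_metric G g \<and>
     (\<forall>F\<in>G. \<forall>v\<in>tangent_space G F. \<forall>w\<in>tangent_space G F. g F (J F v) (J F w) = g F v w)"

text \<open>Extension of tensors from the tangent space at the identity by left translation.\<close>

definition left_translate_endo :: "(mat7 \<Rightarrow> mat7) \<Rightarrow> mat7 \<Rightarrow> mat7 \<Rightarrow> mat7" where
  "left_translate_endo J F v = F ** J (matrix_inv F ** v)"

definition left_translate_form :: "(mat7 \<Rightarrow> mat7 \<Rightarrow> real) \<Rightarrow> mat7 \<Rightarrow> mat7 \<Rightarrow> mat7 \<Rightarrow> real" where
  "left_translate_form g F v w = g (matrix_inv F ** v) (matrix_inv F ** w)"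

section \<open>The group and its Lie algebra\<close>

text \<open>The index type \<^typ>\<open>7\<close> is the integers modulo 7; its seven elements are written \<open>1, \<dots>, 7\<close>,
  where \<open>7 = 0\<close>.\<close>

definition e3 :: "7 \<Rightarrow> 7 \<Rightarrow> 7 \<Rightarrow> real^7 \<Rightarrow> real^7 \<Rightarrow> real^7 \<Rightarrow> real" where
  "e3 i j k u v w =
     det (vector [vector [u$i, u$j, u$k], vector [v$i, v$j, v$k], vector [w$i, w$j, w$k]] :: real^3^3)"

definition phi :: "real^7 \<Rightarrow> real^7 \<Rightarrow> real^7 \<Rightarrow> real" where
  "phi u v w = e3 1 4 7 u v w + e3 2 5 7 u v w + e3 3 6 7 u v w + e3 1 2 3 u v w
               - e3 1 5 6 u v w + e3 2 4 6 u v w - e3 3 4 5 u v w"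

definition G2 :: "mat7 set" where
  "G2 = {F. \<forall>u v w. phi (F *v u) (F *v v) (F *v w) = phi u v w}"

definition g2 :: "mat7 set" where
  "g2 = tangent_space G2 (mat 1)"

definition E_skew :: "7 \<Rightarrow> 7 \<Rightarrow> mat7" where
  "E_skew i j = (\<chi> r c. if r = i \<and> c = j then 1 else if r = j \<and> c = i then - 1 else 0)"

text \<open>The index ranges over \<open>1, \<dots>, 14\<close>; other values are irrelevant.\<close>

definition bas :: "nat \<Rightarrow> mat7" where
  "bas k =
    [E_skew 1 2 - E_skew 6 7, E_skew 1 3 + E_skew 4 6, E_skew 1 7 - E_skew 2 6, E_skew 2 3 - E_skew 4 7,
     E_skew 2 4 + E_skew 1 5, E_skew 2 5 - E_skew 1 4,
     E_skew 2 7 + E_skew 1 6, E_skew 3 4 + E_skew 1 6, E_skew 3 5 + E_skew 2 6,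
     E_skew 3 6 - E_skew 1 4, E_skew 3 7 - E_skew 1 5,
     E_skew 4 5 + E_skew 6 7,
     E_skew 5 6 + E_skew 4 7, E_skew 5 7 - E_skew 4 6] ! (k - 1)"

section \<open>The Samelson complex structure\<close>

definition Jb :: "nat \<Rightarrow> mat7" where
  "Jb k =
    [- (1 / sqrt 3) *\<^sub>R bas 1 - (2 / sqrt 3) *\<^sub>R bas 12, - bas 4, - bas 7, bas 2, - bas 6, bas 5,
     bas 3, bas 3 + bas 9, bas 7 - bas 8, bas 5 + bas 11, bas 6 - bas 10,
     (2 / sqrt 3) *\<^sub>R bas 1 + (1 / sqrt 3) *\<^sub>R bas 12,
     bas 14, - bas 13] ! (k - 1)"

text \<open>The linear map with \<open>samelson (bas k) = Jb k\<close>. Outside the span of the basis the values are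
  meaningless.\<close>

definition samelson :: "mat7 \<Rightarrow> mat7" where
  "samelson X = (\<Sum>k=1..14. real_vector.representation (bas ` {1..14}) X (bas k) *\<^sub>R Jb k)"

section \<open>The Hermitian inner product on the complexification\<close>

type_synonym cmat7 = "complex^7^7"

text \<open>The complexification of the Lie algebra is realised inside the complex matrices.\<close>

definition cscale :: "complex \<Rightarrow> cmat7 \<Rightarrow> cmat7" where
  "cscale c = map_matrix ((*) c)"

interpretation cmat: vector_space cscale
  by unfold_locales (simp_all add: cscale_def vec_eq_iff algebra_simps)

definition complexify :: "mat7 \<Rightarrow> cmat7" where
  "complexify = map_matrix complex_of_real"

definition H_root :: "nat \<Rightarrow> cmat7" where
  "H_root k = complexify ([bas 1, - (1 / sqrt 3) *\<^sub>R bas 1 - (2 / sqrt 3) *\<^sub>R bas 12] ! (k - 1))"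

definition re_im :: "mat7 \<Rightarrow> mat7 \<Rightarrow> cmat7" where
  "re_im U V = complexify U + cscale \<i> (complexify V)"

definition E_root :: "nat \<Rightarrow> cmat7" where
  "E_root j =
    [re_im (bas 5) (bas 6),
     re_im (bas 14) (bas 13),
     re_im (2 *\<^sub>R bas 2 + bas 14) (2 *\<^sub>R bas 4 + bas 13),
     re_im (- (bas 5 + 2 *\<^sub>R bas 11)) (bas 6 - 2 *\<^sub>R bas 10),
     re_im (bas 3) (bas 7),
     re_im (bas 7 - 2 *\<^sub>R bas 8) (bas 3 + 2 *\<^sub>R bas 9)] ! (j - 1)"

definition E_root_conj :: "nat \<Rightarrow> cmat7" where
  "E_root_conj j = map_matrix cnj (E_root j)"

definition root_basis :: "cmat7 set" where
  "root_basis = H_root ` {1..2} \<union> E_root ` {1..6} \<union> E_root_conj ` {1..6}"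

abbreviation coord :: "cmat7 \<Rightarrow> cmat7 \<Rightarrow> complex" where
  "coord \<equiv> cmat.representation root_basis"

definition g_hat :: "(nat \<Rightarrow> real) \<Rightarrow> cmat7 \<Rightarrow> cmat7 \<Rightarrow> complex" where
  "g_hat l X Y =
     of_real (l 0) * (\<Sum>i=1..2. cnj (coord X (H_root i)) * coord Y (H_root i)) +
     (\<Sum>j=1..6. of_real (l j) *
        (cnj (coord X (E_root j)) * coord Y (E_root j) +
         cnj (coord X (E_root_conj j)) * coord Y (E_root_conj j)))"

text \<open>The restriction to \<^term>\<open>g2\<close>, where \<^const>\<open>g_hat\<close> is real-valued.\<close>

definition g_restr :: "(nat \<Rightarrow> real) \<Rightarrow> mat7 \<Rightarrow> mat7 \<Rightarrow> real" where
  "g_restr l X Y = Re (g_hat l (complexify X) (complexify Y))"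

end

theory Submission
  imports Defs
begin

text \<open>The Lie algebra is identified with the annihilator of \<open>\<phi>\<close> in \<open>\<gg>\<ll>(7)\<close>: a matrix annihilating
  \<open>\<phi>\<close> lies in the span of the fourteen basis elements \<open>B\<close>, and each \<open>B\<close> satisfies \<open>B\<^sup>3 = - B\<close>, hence
  generates the curve \<open>1 + sin t B + (1 - cos t) B\<^sup>2\<close> of rotations preserving \<open>\<phi>\<close>. The contraction
  \<open>\<Sum>\<^sub>i\<^sub>j \<phi>(u, e\<^sub>i, e\<^sub>j) \<phi>(v, e\<^sub>i, e\<^sub>j) = 6 \<langle>u, v\<rangle>\<close> makes inversion on the group the restriction of a quadratic
  polynomial, so that left-translated tensors extend smoothly. In the root basis, writing the
  coordinates of a real element along the conjugate pair \<open>E\<^sub>j\<close>, \<open>\<bar>E\<^sub>j\<close> as \<open>(p\<^sub>j \<mp> \<i> q\<^sub>j) / 2\<close>, the metric is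
  diagonal in the \<open>p\<^sub>j\<close>, \<open>q\<^sub>j\<close>, and \<open>\<J>\<close> rotates each pair \<open>(p\<^sub>j, q\<^sub>j)\<close> by a right angle. Integrability
  follows by trivialising vector fields as \<open>V p = p v(p)\<close>: the derivative terms in the Nijenhuis
  tensor cancel because \<open>\<J>\<^sup>2 = -1\<close>, and what remains is its value on the Lie algebra.\<close>

subsection \<open>The three-form and its annihilator\<close>

lemma exhaust_7: "(x::7) = 1 \<or> x = 2 \<or> x = 3 \<or> x = 4 \<or> x = 5 \<or> x = 6 \<or> x = 7"
proof (induct x)
  case (of_int z)
  then have "0 \<le> z" "z < 7" by simp_all
  \<comment> \<open>The case z = 0 yields the element written 7.\<close>
  then have "z = 0 \<or> z = 1 \<or> z = 2 \<or> z = 3 \<or> z = 4 \<or> z = 5 \<or> z = 6" by arith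
  then show ?case by auto
qed

lemma forall_7: "(\<forall>i::7. P i) \<longleftrightarrow> P 1 \<and> P 2 \<and> P 3 \<and> P 4 \<and> P 5 \<and> P 6 \<and> P 7"
  by (metis exhaust_7)

lemma UNIV_7: "(UNIV::7 set) = {1, 2, 3, 4, 5, 6, 7}"
  using exhaust_7 by auto

lemma sum_7: "sum f (UNIV::7 set) = f 1 + f 2 + f 3 + f 4 + f 5 + f 6 + f 7"
  unfolding UNIV_7 by (simp add: ac_simps)

lemma e3_expand:
  "e3 i j k u v w =
    u$i * v$j * w$k + u$j * v$k * w$i + u$k * v$i * w$j
    - u$i * v$k * w$j - u$j * v$i * w$k - u$k * v$j * w$i"
  by (simp add: e3_def det_3)

text \<open>The infinitesimal action of \<open>A\<close> on \<open>phi\<close>: the derivative of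
  the pullbacks of \<open>phi\<close> along a curve of matrices through the identity with velocity
  \<open>A\<close>.\<close>

definition phi_deriv :: "mat7 \<Rightarrow> real^7 \<Rightarrow> real^7 \<Rightarrow> real^7 \<Rightarrow> real" where
  "phi_deriv A u v w = phi (A *v u) v w + phi u (A *v v) w + phi u v (A *v w)"

definition annih :: "mat7 set" where
  "annih = {A. \<forall>u v w. phi_deriv A u v w = 0}"

lemma phi_linear:
  "phi (a *\<^sub>R u + b *\<^sub>R u') v w = a * phi u v w + b * phi u' v w"
  "phi u (a *\<^sub>R v + b *\<^sub>R v') w = a * phi u v w + b * phi u v' w"
  "phi u v (a *\<^sub>R w + b *\<^sub>R w') = a * phi u v w + b * phi u v w'"
  by (simp_all add: phi_def e3_expand algebra_simps)

text \<open>Each coordinate of \<open>u\<close> equals, up to sign, phi(u, e_i, e_j) for exactly six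
  ordered pairs (i, j), and the signs agree with those for \<open>v\<close>; hence the factor
  6.\<close>

lemma phi_contraction:
  "(\<Sum>i\<in>UNIV. \<Sum>j\<in>UNIV. phi u (axis i 1) (axis j 1) * phi v (axis i 1) (axis j 1)) = 6 * (u \<bullet> v)"
  by (simp add: sum_7 phi_def e3_expand axis_def inner_vec_def)

text \<open>The coordinates in the basis \<^const>\<open>bas\<close> can be read off from fourteen matrix entries.\<close>

definition coef :: "nat \<Rightarrow> 'a^7^7 \<Rightarrow> 'a" where
  "coef k X = [X$1$2, X$1$3, X$1$7, X$2$3, X$2$4, X$2$5, X$2$7, X$3$4, X$3$5, X$3$6, X$3$7,
     X$4$5, X$5$6, X$5$7] ! (k - 1)"

lemma sum_14: "(\<Sum>k=1..14. f k) = f 1 + f 2 + f 3 + f 4 + f 5 + f 6 + f 7 + f 8 + f 9 + f 10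
    + f 11 + f 12 + f 13 + f (14::nat)"
  by (simp add: numeral_eq_Suc atLeastAtMostSuc_conv ac_simps)

text \<open>Since \<open>coef\<close> is dual to \<open>bas\<close>, this is a linear projection of
  all matrices onto the span of the basis. Being defined everywhere, it can be composed with
  extended fields and differentiated.\<close>

definition g2_proj :: "mat7 \<Rightarrow> mat7" where
  "g2_proj X = (\<Sum>k=1..14. coef k X *\<^sub>R bas k)"

lemma atLeastAtMost_14: "{1..14::nat} = {1, 2, 3, 4, 5, 6, 7, 8, 9, 10, 11, 12, 13, 14}"
  by (simp add: numeral_eq_Suc atLeastAtMostSuc_conv insert_commute)

lemma phi_axis:
  "phi u (axis 1 1) (axis 2 1) = u$3" "phi u (axis 1 1) (axis 3 1) = - u$2"
  "phi u (axis 1 1) (axis 4 1) = u$7" "phi u (axis 1 1) (axis 5 1) = - u$6"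
  "phi u (axis 1 1) (axis 6 1) = u$5" "phi u (axis 1 1) (axis 7 1) = - u$4"
  "phi u (axis 2 1) (axis 1 1) = - u$3" "phi u (axis 2 1) (axis 3 1) = u$1"
  "phi u (axis 2 1) (axis 4 1) = u$6" "phi u (axis 2 1) (axis 5 1) = u$7"
  "phi u (axis 2 1) (axis 6 1) = - u$4" "phi u (axis 2 1) (axis 7 1) = - u$5"
  "phi u (axis 3 1) (axis 1 1) = u$2" "phi u (axis 3 1) (axis 2 1) = - u$1"
  "phi u (axis 3 1) (axis 4 1) = - u$5" "phi u (axis 3 1) (axis 5 1) = u$4"
  "phi u (axis 3 1) (axis 6 1) = u$7" "phi u (axis 3 1) (axis 7 1) = - u$6"
  "phi u (axis 4 1) (axis 1 1) = - u$7" "phi u (axis 4 1) (axis 2 1) = - u$6"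
  "phi u (axis 4 1) (axis 3 1) = u$5" "phi u (axis 4 1) (axis 5 1) = - u$3"
  "phi u (axis 4 1) (axis 6 1) = u$2" "phi u (axis 4 1) (axis 7 1) = u$1"
  "phi u (axis 5 1) (axis 1 1) = u$6" "phi u (axis 5 1) (axis 2 1) = - u$7"
  "phi u (axis 5 1) (axis 3 1) = - u$4" "phi u (axis 5 1) (axis 4 1) = u$3"
  "phi u (axis 5 1) (axis 6 1) = - u$1" "phi u (axis 5 1) (axis 7 1) = u$2"
  "phi u (axis 6 1) (axis 1 1) = - u$5" "phi u (axis 6 1) (axis 2 1) = u$4"
  "phi u (axis 6 1) (axis 3 1) = - u$7" "phi u (axis 6 1) (axis 4 1) = - u$2"
  "phi u (axis 6 1) (axis 5 1) = u$1" "phi u (axis 6 1) (axis 7 1) = u$3"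
  "phi u (axis 7 1) (axis 1 1) = u$4" "phi u (axis 7 1) (axis 2 1) = u$5"
  "phi u (axis 7 1) (axis 3 1) = u$6" "phi u (axis 7 1) (axis 4 1) = - u$1"
  "phi u (axis 7 1) (axis 5 1) = - u$2" "phi u (axis 7 1) (axis 6 1) = - u$3"
  by (simp_all add: phi_def e3_expand axis_def)

lemma phi_cyclic: "phi u v w = phi v w u"
  by (simp add: phi_def e3_expand algebra_simps)

lemma E_skew_mult_vec:
  assumes "a \<noteq> b"
  shows "(E_skew a b *v x) $ i = (if i = a then x $ b else if i = b then - x $ a else 0)"
proof -
  have "(E_skew a b *v x) $ i = (\<Sum>j\<in>UNIV. (if j = b then (if i = a then x $ j else 0) else 0)
      + (if j = a then (if i = b then - x $ j else 0) else 0))"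
    unfolding E_skew_def matrix_vector_mult_def using assms by (auto intro!: sum.cong)
  also have "\<dots> = (if i = a then x $ b else if i = b then - x $ a else 0)"
    using assms by (simp add: sum.distrib)
  finally show ?thesis .
qed

lemma annih_bas:
  assumes "k \<in> {1..14}" shows "bas k \<in> annih"
proof -
  have "\<forall>k\<in>{1..14}. phi_deriv (bas k) u v w = 0" for u v w
    unfolding atLeastAtMost_14 ball_simps
    by (intro conjI TrueI; simp add: bas_def phi_deriv_def phi_def e3_expand
        matrix_vector_mult_add_rdistrib matrix_vector_mult_diff_rdistrib E_skew_mult_vec; simp add: algebra_simps)
  with assms show ?thesis by (simp add: annih_def)
qed

text \<open>Cyclic symmetry moves each column of \<open>X\<close> into the first slot, where
  \<open>phi_axis\<close> turns it into a single matrix entry.\<close>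

lemma annih_entries:
  assumes "X \<in> annih" "i \<noteq> j" "j \<noteq> k" "k \<noteq> i"
  shows "phi (column i X) (axis j 1) (axis k 1) + phi (column j X) (axis k 1) (axis i 1) +
    phi (column k X) (axis i 1) (axis j 1) = 0"
  using assms phi_cyclic
  by (simp add: annih_def phi_deriv_def flip: matrix_vector_mul_component matrix_vector_mult_basis)

text \<open>The 35 basis triples i < j < k give 35 linear equations for the 49 entries; solving them
  leaves free exactly the 14 entries that \<open>coef\<close> reads.\<close>

lemma annih_dependent_entries:
  assumes "X \<in> annih"
  shows
    "X$1$1 = 0" "X$2$2 = 0" "X$3$3 = 0" "X$4$4 = 0" "X$5$5 = 0" "X$6$6 = 0" "X$7$7 = 0"
    "X$2$1 = - (X$1$2)" "X$3$1 = - (X$1$3)" "X$1$4 = - X$2$5 - X$3$6" "X$4$1 = - (- X$2$5 - X$3$6)"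
    "X$1$5 = X$2$4 - X$3$7" "X$5$1 = - (X$2$4 - X$3$7)" "X$1$6 = X$2$7 + X$3$4"
    "X$6$1 = - (X$2$7 + X$3$4)" "X$7$1 = - (X$1$7)" "X$3$2 = - (X$2$3)" "X$4$2 = - (X$2$4)"
    "X$5$2 = - (X$2$5)" "X$2$6 = X$3$5 - X$1$7" "X$6$2 = - (X$3$5 - X$1$7)" "X$7$2 = - (X$2$7)"
    "X$4$3 = - (X$3$4)" "X$5$3 = - (X$3$5)" "X$6$3 = - (X$3$6)" "X$7$3 = - (X$3$7)"
    "X$5$4 = - (X$4$5)" "X$4$6 = X$1$3 - X$5$7" "X$6$4 = - (X$1$3 - X$5$7)" "X$4$7 = X$5$6 - X$2$3"
    "X$7$4 = - (X$5$6 - X$2$3)" "X$6$5 = - (X$5$6)" "X$7$5 = - (X$5$7)" "X$6$7 = X$4$5 - X$1$2"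
    "X$7$6 = - (X$4$5 - X$1$2)"
proof -
  note P = annih_entries[OF assms]
  note Q = P[of 1 2 3] P[of 1 2 4] P[of 1 2 5] P[of 1 2 6] P[of 1 2 7]
    P[of 1 3 4] P[of 1 3 5] P[of 1 3 6] P[of 1 3 7] P[of 1 4 5]
    P[of 1 4 6] P[of 1 4 7] P[of 1 5 6] P[of 1 5 7] P[of 1 6 7]
    P[of 2 3 4] P[of 2 3 5] P[of 2 3 6] P[of 2 3 7] P[of 2 4 5]
    P[of 2 4 6] P[of 2 4 7] P[of 2 5 6] P[of 2 5 7] P[of 2 6 7]
    P[of 3 4 5] P[of 3 4 6] P[of 3 4 7] P[of 3 5 6] P[of 3 5 7]
    P[of 3 6 7] P[of 4 5 6] P[of 4 5 7] P[of 4 6 7] P[of 5 6 7]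
  note R = Q[simplified phi_axis column_def, simplified]
  show "X$1$1 = 0" "X$2$2 = 0" "X$3$3 = 0" "X$4$4 = 0" "X$5$5 = 0" "X$6$6 = 0" "X$7$7 = 0"
    "X$2$1 = - (X$1$2)" "X$3$1 = - (X$1$3)" "X$1$4 = - X$2$5 - X$3$6" "X$4$1 = - (- X$2$5 - X$3$6)"
    "X$1$5 = X$2$4 - X$3$7" "X$5$1 = - (X$2$4 - X$3$7)" "X$1$6 = X$2$7 + X$3$4"
    "X$6$1 = - (X$2$7 + X$3$4)" "X$7$1 = - (X$1$7)" "X$3$2 = - (X$2$3)" "X$4$2 = - (X$2$4)"
    "X$5$2 = - (X$2$5)" "X$2$6 = X$3$5 - X$1$7" "X$6$2 = - (X$3$5 - X$1$7)" "X$7$2 = - (X$2$7)"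
    "X$4$3 = - (X$3$4)" "X$5$3 = - (X$3$5)" "X$6$3 = - (X$3$6)" "X$7$3 = - (X$3$7)"
    "X$5$4 = - (X$4$5)" "X$4$6 = X$1$3 - X$5$7" "X$6$4 = - (X$1$3 - X$5$7)" "X$4$7 = X$5$6 - X$2$3"
    "X$7$4 = - (X$5$6 - X$2$3)" "X$6$5 = - (X$5$6)" "X$7$5 = - (X$5$7)" "X$6$7 = X$4$5 - X$1$2"
    "X$7$6 = - (X$4$5 - X$1$2)"
    using R by linarith+
qed

lemma annih_eq_proj: assumes "X \<in> annih" shows "g2_proj X = X"
  unfolding vec_eq_iff forall_7 g2_proj_def sum_14
  by (simp add: coef_def bas_def E_skew_def annih_dependent_entries[OF assms])

lemma phi_deriv_linear:
  "phi_deriv (a *\<^sub>R A + b *\<^sub>R B) u v w = a * phi_deriv A u v w + b * phi_deriv B u v w"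
  by (simp add: phi_deriv_def matrix_vector_mult_add_rdistrib phi_linear algebra_simps
      flip: scaleR_matrix_vector_assoc)

lemma annih_subspace: "subspace annih"
proof (rule subspaceI)
  show "0 \<in> annih" using phi_deriv_linear[of 0 _ 0] by (simp add: annih_def)
  show "A + B \<in> annih" if "A \<in> annih" "B \<in> annih" for A B
    using that phi_deriv_linear[of 1 A 1 B] by (simp add: annih_def)
  show "c *\<^sub>R A \<in> annih" if "A \<in> annih" for c A
    using that phi_deriv_linear[of c A 0 0] by (simp add: annih_def)
qed

lemma annih_ext:
  assumes "X \<in> annih" "Y \<in> annih" "\<And>k. k \<in> {1..14} \<Longrightarrow> coef k X = coef k Y"
  shows "X = Y"
proof -
  have "g2_proj X = g2_proj Y" unfolding g2_proj_def using assms(3) by (intro sum.cong) auto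
  then show ?thesis by (simp add: annih_eq_proj assms)
qed

lemma g2_proj_annih: "g2_proj X \<in> annih"
  unfolding g2_proj_def
  by (intro subspace_sum subspace_scale annih_subspace annih_bas)

subsection \<open>Coordinates and the complex structure\<close>

text \<open>A dual family of functionals forces \<open>f\<close> to be injective with independent
  image, so the abstract coordinates can be read off. It serves both the real basis
  \<open>bas\<close> and the complex root basis.\<close>

lemma (in vector_space) representation_image_dual:
  assumes fin: "finite I" and i: "i \<in> I"
    and add: "\<And>i x y. i \<in> I \<Longrightarrow> d i (x + y) = d i x + d i y"
    and scl: "\<And>i c x. i \<in> I \<Longrightarrow> d i (scale c x) = c * d i x"
    and dual: "\<And>i j. i \<in> I \<Longrightarrow> j \<in> I \<Longrightarrow> d i (f j) = (if i = j then 1 else 0)"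
  shows "representation (f ` I) (\<Sum>j\<in>I. scale (c j) (f j)) (f i) = c i"
proof -
  have zero: "d i 0 = 0" if "i \<in> I" for i
    using scl[OF that, of 0 0] by simp
  have d_sum: "d i (\<Sum>j\<in>I. scale (u j) (f j)) = u i" if "i \<in> I" for i u
  proof -
    have "d i (\<Sum>j\<in>J. scale (u j) (f j)) = (\<Sum>j\<in>J. u j * d i (f j))" if "finite J" for J
      using that by (induction J) (simp_all add: zero add scl \<open>i \<in> I\<close>)
    also have "(\<Sum>j\<in>I. u j * d i (f j)) = (\<Sum>j\<in>I. if i = j then u j else 0)"
      by (intro sum.cong) (simp_all add: dual that)
    finally show ?thesis using fin that by simp
  qed
  have inj: "inj_on f I"
    by (rule inj_onI) (metis dual zero_neq_one)
  have indep: "independent (f ` I)"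
  proof (rule independent_if_scalars_zero)
    show "finite (f ` I)" using fin by simp
    fix u x assume *: "(\<Sum>x\<in>f ` I. scale (u x) x) = 0" and "x \<in> f ` I"
    then obtain j where j: "j \<in> I" "x = f j" by blast
    have "(\<Sum>j\<in>I. scale (u (f j)) (f j)) = 0" using * by (simp add: sum.reindex[OF inj])
    with d_sum[OF j(1), of "\<lambda>j. u (f j)"] show "u x = 0" by (simp add: zero j)
  qed
  have sp: "f j \<in> span (f ` I)" if "j \<in> I" for j using that by (simp add: span_base)
  have "representation (f ` I) (\<Sum>j\<in>I. scale (c j) (f j)) (f i)
      = (\<Sum>j\<in>I. c j * (if f i = f j then 1 else 0))"
    using sp by (simp add: representation_sum[OF indep] span_scale representation_scale[OF indep]
        representation_basis[OF indep])
  also have "\<dots> = (\<Sum>j\<in>I. if j = i then c j else 0)"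
    using inj i by (intro sum.cong) (auto dest: inj_onD)
  finally show ?thesis using fin i by simp
qed

text \<open>A linear map on all matrices; \<^const>\<open>samelson\<close> itself vanishes off the span of the basis.\<close>

definition Jlin :: "mat7 \<Rightarrow> mat7" where
  "Jlin X = (\<Sum>k=1..14. coef k X *\<^sub>R Jb k)"

lemma coef_add: "k \<in> {1..14} \<Longrightarrow> coef k (X + Y) = coef k X + coef k (Y :: 'a::semiring_1^7^7)"
  unfolding atLeastAtMost_14 by (auto simp: coef_def)

lemma coef_scale: "k \<in> {1..14} \<Longrightarrow> coef k (c *\<^sub>R X) = c * coef k X"
  unfolding atLeastAtMost_14 by (auto simp: coef_def)

lemma coef_bas: "i \<in> {1..14} \<Longrightarrow> j \<in> {1..14} \<Longrightarrow> coef i (bas j) = (if i = j then 1 else 0)"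
proof -
  have "\<forall>i\<in>{1..14}. \<forall>j\<in>{1..14}. coef i (bas j) = (if i = j then 1 else 0)"
    unfolding atLeastAtMost_14 by (simp add: coef_def bas_def E_skew_def)
  then show "i \<in> {1..14} \<Longrightarrow> j \<in> {1..14} \<Longrightarrow> ?thesis" by blast
qed

text \<open>An element of \<open>annih\<close> equals its \<open>g2_proj\<close>, and duality of
  \<open>coef\<close> and \<open>bas\<close> identifies its coordinates with the values of
  \<open>coef\<close>.\<close>

lemma samelson_eq_Jlin:
  assumes "X \<in> annih" shows "samelson X = Jlin X"
proof -
  have "real_vector.representation (bas ` {1..14}) X (bas k) = coef k X" if "k \<in> {1..14}" for k
    using real_vector.representation_image_dual[of "{1..14}" k coef bas "\<lambda>k. coef k X"] that
      annih_eq_proj[OF assms]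
    by (simp add: coef_add coef_scale coef_bas g2_proj_def)
  then show ?thesis unfolding samelson_def Jlin_def by (intro sum.cong) auto
qed

lemma Jb_annih: "k \<in> {1..14} \<Longrightarrow> Jb k \<in> annih"
proof -
  note s = annih_subspace
  have "\<forall>k\<in>{1..14}. Jb k \<in> annih"
    unfolding atLeastAtMost_14
    by (simp add: Jb_def annih_bas subspace_add[OF s] subspace_diff[OF s] subspace_scale[OF s]
        subspace_neg[OF s])
  then show "k \<in> {1..14} \<Longrightarrow> ?thesis" by blast
qed

lemma Jlin_annih: "Jlin X \<in> annih"
  unfolding Jlin_def by (intro subspace_sum subspace_scale annih_subspace Jb_annih)

lemma coef_diff: "k \<in> {1..14} \<Longrightarrow> coef k (X - Y) = coef k X - coef k (Y :: 'a::ring_1^7^7)"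
  unfolding atLeastAtMost_14 by (auto simp: coef_def)

lemma coef_minus: "k \<in> {1..14} \<Longrightarrow> coef k (- X) = - coef k (X :: 'a::ring_1^7^7)"
  unfolding atLeastAtMost_14 by (auto simp: coef_def)

lemmas coef_simps = coef_add coef_diff coef_minus coef_scale coef_bas

lemma linear_Jlin: "linear Jlin"
  by (rule linearI)
    (simp_all add: Jlin_def coef_add coef_scale scaleR_add_left sum.distrib scaleR_sum_right
        del: One_nat_def)

lemma linear_g2_proj: "linear g2_proj"
  by (rule linearI)
    (simp_all add: g2_proj_def coef_add coef_scale scaleR_add_left sum.distrib scaleR_sum_right
        del: One_nat_def)

text \<open>The rows of the coordinate matrix whose columns are given by \<open>Jb\<close>.\<close>

lemma coef_Jlin:
  "coef 1 (Jlin X) = (2 * coef 12 X - coef 1 X) / sqrt 3"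
  "coef 2 (Jlin X) = coef 4 X"
  "coef 3 (Jlin X) = coef 7 X + coef 8 X"
  "coef 4 (Jlin X) = - coef 2 X"
  "coef 5 (Jlin X) = coef 6 X + coef 10 X"
  "coef 6 (Jlin X) = coef 11 X - coef 5 X"
  "coef 7 (Jlin X) = coef 9 X - coef 3 X"
  "coef 8 (Jlin X) = - coef 9 X"
  "coef 9 (Jlin X) = coef 8 X"
  "coef 10 (Jlin X) = - coef 11 X"
  "coef 11 (Jlin X) = coef 10 X"
  "coef 12 (Jlin X) = (coef 12 X - 2 * coef 1 X) / sqrt 3"
  "coef 13 (Jlin X) = - coef 14 X"
  "coef 14 (Jlin X) = coef 13 X"
  unfolding Jlin_def sum_14
  by (simp_all add: coef_simps Jb_def diff_divide_distrib del: One_nat_def)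

lemma Jlin_Jlin:
  assumes "X \<in> annih" shows "Jlin (Jlin X) = - X"
proof (rule annih_ext)
  fix k :: nat assume "k \<in> {1..14}"
  moreover have "\<forall>k\<in>{1..14}. coef k (Jlin (Jlin X)) = coef k (- X)"
    unfolding atLeastAtMost_14 ball_simps
    \<comment> \<open>Coordinates stay folded until both applications of \<open>Jlin\<close> are
      evaluated.\<close>
    by (simp only: coef_Jlin) (simp add: coef_def field_simps)
  ultimately show "coef k (Jlin (Jlin X)) = coef k (- X)" by blast
qed (use assms in \<open>auto intro: Jlin_annih subspace_neg[OF annih_subspace]\<close>)

subsection \<open>The inner product in the root basis\<close>

text \<open>The solution x_1, x_2 of x_1 H_1 + x_2 H_2 = a b_1 + c b_12, where a and c are
  coefficients 1 and 12. The type covers real and complex matrices alike.\<close>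

definition H_coord :: "nat \<Rightarrow> 'a::real_field^7^7 \<Rightarrow> 'a" where
  "H_coord j X = [coef 1 X - coef 12 X / 2, - (of_real (sqrt 3) / 2) * coef 12 X] ! (j - 1)"

text \<open>For real \<open>X\<close> the coordinate along \<open>E\<^sub>j\<close> is \<open>(re_coord j X - \<i> im_coord j X) / 2\<close>. Both functionals are
  extended complex linearly, so on complex matrices they are not real and imaginary parts.\<close>

definition re_coord :: "nat \<Rightarrow> 'a::field^7^7 \<Rightarrow> 'a" where
  "re_coord j X = [coef 5 X - coef 11 X / 2, coef 14 X - coef 2 X / 2, coef 2 X / 2,
     - (coef 11 X / 2), coef 3 X - coef 9 X / 2, - (coef 8 X / 2)] ! (j - 1)"

definition im_coord :: "nat \<Rightarrow> 'a::field^7^7 \<Rightarrow> 'a" where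
  "im_coord j X = [coef 6 X + coef 10 X / 2, coef 13 X - coef 4 X / 2, coef 4 X / 2,
     - (coef 10 X / 2), coef 7 X + coef 8 X / 2, coef 9 X / 2] ! (j - 1)"

text \<open>Indices \<open>1, 2\<close> enumerate the \<open>H\<close>, \<open>3, \<dots>, 8\<close> the \<open>E\<close> and \<open>9, \<dots>, 14\<close> their conjugates.\<close>

definition root_vec :: "nat \<Rightarrow> cmat7" where
  "root_vec k = (if k \<le> 2 then H_root k else if k \<le> 8 then E_root (k - 2) else E_root_conj (k - 8))"

text \<open>With E = U + iV, the combination x E + y conj(E) has coefficients p = x + y along U and
  q = i(x - y) along V; solving for x and y gives the two fractions.\<close>

definition root_dual :: "nat \<Rightarrow> cmat7 \<Rightarrow> complex" where
  "root_dual k X = (if k \<le> 2 then H_coord k X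
     else if k \<le> 8 then (re_coord (k - 2) X - \<i> * im_coord (k - 2) X) / 2
     else (re_coord (k - 8) X + \<i> * im_coord (k - 8) X) / 2)"

text \<open>A single index interval brings the root basis into the form required by
  \<open>representation_image_dual\<close>.\<close>

lemma root_basis_eq: "root_basis = root_vec ` {1..14}"
proof -
  have "{1..2::nat} = {1, 2}" "{1..6::nat} = {1, 2, 3, 4, 5, 6}" by auto
  then show ?thesis unfolding root_basis_def atLeastAtMost_14
    by (simp add: root_vec_def)
qed

lemma coef_complex:
  assumes "k \<in> {1..14}"
  shows "coef k (complexify X) = of_real (coef k X)" "coef k (cscale c M) = c * coef k M"
    "coef k (map_matrix cnj M) = cnj (coef k M)"
  using assms unfolding atLeastAtMost_14
  by (auto simp: coef_def complexify_def cscale_def map_matrix_def)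

lemma coef_root_vec:
  assumes "k \<in> {1..14}"
  shows "coef k (root_vec j) = (if j \<le> 2 then coef k (H_root j)
    else if j \<le> 8 then coef k (E_root (j - 2)) else cnj (coef k (E_root (j - 8))))"
  by (simp add: root_vec_def E_root_conj_def coef_complex[OF assms])

lemma root_dual_root_vec:
  assumes "i \<in> {1..14}" "j \<in> {1..14}"
  shows "root_dual i (root_vec j) = (if i = j then 1 else 0)"
proof -
  have "\<forall>i\<in>{1..14}. \<forall>j\<in>{1..14}. root_dual i (root_vec j) = (if i = j then 1 else 0)"
    unfolding atLeastAtMost_14
    by (simp add: root_dual_def H_coord_def re_coord_def im_coord_def coef_root_vec H_root_def
        E_root_def re_im_def coef_complex coef_simps del: One_nat_def flip: of_real_mult)
  then show ?thesis using assms by blast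
qed

section \<open>Commutators and the Nijenhuis tensor on the Lie algebra\<close>

definition comm :: "mat7 \<Rightarrow> mat7 \<Rightarrow> mat7" where
  "comm X Y = X ** Y - Y ** X"

text \<open>Inserting \<open>Y\<close> into each slot of the condition for \<open>X\<close> produces
  the action of \<open>X ** Y\<close> plus mixed terms symmetric in \<open>X\<close> and
  \<open>Y\<close>; these cancel against the same expression with the roles exchanged.\<close>

lemma comm_annih:
  assumes "X \<in> annih" "Y \<in> annih" shows "comm X Y \<in> annih"
proof -
  have "phi_deriv (comm X Y) u v w = 0" for u v w
  proof -
    have X: "phi_deriv X u v w = 0" and Y: "phi_deriv Y u v w = 0" for u v w
      using assms by (simp_all add: annih_def)
    note X[of "Y *v u" v w] X[of u "Y *v v" w] X[of u v "Y *v w"]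
      Y[of "X *v u" v w] Y[of u "X *v v" w] Y[of u v "X *v w"]
    moreover have "phi_deriv (comm X Y) u v w = phi_deriv (X ** Y) u v w - phi_deriv (Y ** X) u v w"
      using phi_deriv_linear[of 1 "X ** Y" "- 1" "Y ** X"] by (simp add: comm_def)
    ultimately show ?thesis
      by (simp add: phi_deriv_def matrix_vector_mul_assoc)
  qed
  then show ?thesis by (simp add: annih_def)
qed

text \<open>The structure constants of the Lie algebra, expressed through the minors
  \<open>w i j\<close> because the bracket is alternating.\<close>

lemma coef_comm:
  assumes "X \<in> annih" "Y \<in> annih"
  defines "w \<equiv> \<lambda>i j. coef i X * coef j Y - coef j X * coef i Y"
  shows
  "coef 1 (comm X Y) = - w 2 4 - 2 * w 3 7 - w 3 8 - 2 * w 5 6 - w 5 10 - w 6 11 - w 7 9 - w 8 9"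
  "coef 2 (comm X Y) = w 1 4 - w 3 11 - w 5 9 + w 6 8 - w 7 10 - 2 * w 8 10 - w 9 11"
  "coef 3 (comm X Y) = 2 * w 1 7 + w 1 8 + w 2 11 - w 4 6 - w 4 10 + w 5 14 - w 6 13 + w 7 12
      + w 8 12 - w 10 13 - w 11 14"
  "coef 4 (comm X Y) = - w 1 2 + w 3 10 - w 5 8 - w 6 9 - w 7 11 - w 9 10"
  "coef 5 (comm X Y) = w 1 6 + w 1 10 - w 2 3 + w 2 9 - w 3 14 - w 4 7 + w 4 8 - w 6 12 - w 7 13
      + w 9 14"
  "coef 6 (comm X Y) = - w 1 5 + w 1 11 + w 3 13 + w 4 9 + w 5 12 - w 7 14 - w 9 13"
  "coef 7 (comm X Y) = - 2 * w 1 3 + w 1 9 - w 3 12 + w 4 5 + w 4 11 + w 5 13 + w 6 14 + w 9 12"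
  "coef 8 (comm X Y) = w 2 6 + 2 * w 2 10 - w 4 5 - w 4 11 - w 9 12 + w 10 14 - w 11 13"
  "coef 9 (comm X Y) = - w 2 5 + w 2 11 - w 4 6 + w 8 12 - w 10 13 - w 11 14"
  "coef 10 (comm X Y) = - w 1 11 - w 2 7 - 2 * w 2 8 - w 3 4 - w 4 9 - w 8 14 + w 9 13 - w 11 12"
  "coef 11 (comm X Y) = w 1 10 - w 2 3 - w 4 7 + w 4 8 + w 8 13 + w 9 14 + w 10 12"
  "coef 12 (comm X Y) = - w 2 13 + w 4 14 - 2 * w 5 6 - w 5 10 - w 6 11 - w 8 9 - w 10 11
      - 2 * w 13 14"
  "coef 13 (comm X Y) = - w 1 14 + w 2 12 - w 3 6 - w 5 7 - w 5 8 - w 6 9 - w 7 11 - w 8 11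
      - w 9 10 + 2 * w 12 14"
  "coef 14 (comm X Y) = w 1 13 + w 3 5 - w 3 11 - w 4 12 - w 6 7 - w 9 11 - 2 * w 12 13"
  unfolding w_def
  by (simp_all add: coef_def comm_def matrix_matrix_mult_def sum_7
      annih_dependent_entries[OF assms(1)] annih_dependent_entries[OF assms(2)] algebra_simps)

lemma coef_zero: "k \<in> {1..14} \<Longrightarrow> coef k (0 :: 'a::zero^7^7) = 0"
  unfolding atLeastAtMost_14 by (auto simp: coef_def)

lemma samelson_nijenhuis:
  assumes "X \<in> annih" "Y \<in> annih"
  shows "comm (Jlin X) (Jlin Y) - Jlin (comm (Jlin X) Y) - Jlin (comm X (Jlin Y)) - comm X Y = 0"
    (is "?N = 0")
proof (rule annih_ext)
  fix k :: nat assume k: "k \<in> {1..14}"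
  \<comment> \<open>With 1 / sqrt 3 as an atom subject only to s * s = 1 / 3, the fourteen
    identities become polynomial ones in the coordinates.\<close>
  define s where "s = 1 / sqrt 3"
  have s: "x / sqrt 3 = s * x" for x by (simp add: s_def)
  have s2: "s * (s * x) = x / 3" for x by (simp add: s_def field_simps)
  note c = coef_comm[OF Jlin_annih Jlin_annih] coef_comm[OF assms]
    coef_comm[OF Jlin_annih assms(2)] coef_comm[OF assms(1) Jlin_annih]
  have "\<forall>k\<in>{1..14}. coef k ?N = coef k 0"
    unfolding atLeastAtMost_14 ball_simps
    by (intro conjI TrueI; simp add: coef_diff coef_zero coef_Jlin c s del: One_nat_def;
        simp add: algebra_simps s2)
  then show "coef k ?N = coef k 0"
    using k by blast
next
  note a = annih_subspace
  show "0 \<in> annih" by (rule subspace_0[OF a])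
  show "?N \<in> annih"
    by (intro subspace_diff[OF a] comm_annih Jlin_annih assms)
qed

section \<open>Expansion of real elements in the root basis\<close>

lemma complexify_linear:
  "complexify (a *\<^sub>R X + Y) = cscale (of_real a) (complexify X) + complexify Y"
  by (simp add: complexify_def cscale_def map_matrix_def vec_eq_iff)

text \<open>The complex counterpart of \<open>g2_proj\<close>. Matrices fixed by it are determined
  by their fourteen coefficients, so it reduces matrix identities to scalar ones.\<close>

definition cproj :: "cmat7 \<Rightarrow> cmat7" where
  "cproj M = (\<Sum>k=1..14. cscale (coef k M) (complexify (bas k)))"

lemma cproj_add: "cproj (M + N) = cproj M + cproj N"
  unfolding cproj_def sum_14 by (simp add: coef_add cmat.scale_left_distrib del: One_nat_def)

lemma cproj_scale: "cproj (cscale c M) = cscale c (cproj M)"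
  unfolding cproj_def sum_14 by (simp add: coef_complex cmat.scale_right_distrib del: One_nat_def)

lemma cproj_sum: "finite I \<Longrightarrow> cproj (\<Sum>i\<in>I. f i) = (\<Sum>i\<in>I. cproj (f i))"
proof (induction I rule: finite_induct)
  case empty
  then show ?case using cproj_scale[of 0 0] by simp
qed (simp add: cproj_add)

lemma cproj_complexify:
  assumes "X \<in> annih" shows "cproj (complexify X) = complexify X"
proof -
  have "complexify (\<Sum>k\<in>I. c k *\<^sub>R f k) = (\<Sum>k\<in>I. cscale (of_real (c k)) (complexify (f k)))"
    if "finite I" for c f and I :: "nat set"
    using that
    by (induction I rule: finite_induct)
      (simp_all add: complexify_linear, simp add: complexify_def map_matrix_def vec_eq_iff)
  from this[of "{1..14}" "\<lambda>k. coef k X" bas] have "complexify (g2_proj X) = cproj (complexify X)"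
    unfolding g2_proj_def cproj_def by (simp add: coef_complex)
  then show ?thesis by (simp add: annih_eq_proj assms)
qed

lemma cproj_re_im:
  assumes "X \<in> annih" "Y \<in> annih" shows "cproj (re_im X Y) = re_im X Y"
  by (simp add: re_im_def cproj_add cproj_scale cproj_complexify assms)

lemma cnj_re_im: "map_matrix cnj (re_im X Y) = re_im X (- Y)"
  by (simp add: re_im_def complexify_def cscale_def map_matrix_def vec_eq_iff)

lemma cproj_root_vec:
  assumes "k \<in> {1..14}" shows "cproj (root_vec k) = root_vec k"
proof -
  note s = annih_subspace
  have "\<forall>k\<in>{1..14}. cproj (root_vec k) = root_vec k"
    unfolding atLeastAtMost_14
    by (simp add: root_vec_def H_root_def E_root_def E_root_conj_def cnj_re_im cproj_re_im
        cproj_complexify annih_bas subspace_add[OF s] subspace_diff[OF s] subspace_scale[OF s]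
        subspace_neg[OF s])
  with assms show ?thesis by blast
qed

text \<open>Both sides are fixed by \<open>cproj\<close>, so it suffices to compare
  coefficients.\<close>

lemma root_expansion:
  assumes "X \<in> annih"
  shows "complexify X = (\<Sum>k=1..14. cscale (root_dual k (complexify X)) (root_vec k))"
    (is "?M = ?N")
proof -
  have M: "cproj ?M = ?M" by (rule cproj_complexify[OF assms])
  have N: "cproj ?N = ?N" by (simp add: cproj_sum cproj_scale cproj_root_vec)
  have s: "complex_of_real (sqrt 3) * complex_of_real (sqrt 3) = 3"
    by (simp flip: of_real_mult)
  have "\<forall>k\<in>{1..14}. coef k ?M = coef k ?N"
    unfolding sum_14 unfolding atLeastAtMost_14
    by (simp add: coef_complex coef_simps coef_root_vec H_root_def E_root_def re_im_def
        root_dual_def H_coord_def re_coord_def im_coord_def del: One_nat_def)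
      (simp add: field_simps s)
  then have "cproj ?M = cproj ?N" unfolding cproj_def by (intro sum.cong) auto
  with M N show ?thesis by simp
qed

text \<open>The functionals \<open>root_dual\<close> are linear and dual to the root vectors, so
  they compute the coordinates of the expansion.\<close>

lemma coord_root_vec:
  assumes "X \<in> annih" "k \<in> {1..14}"
  shows "coord (complexify X) (root_vec k) = root_dual k (complexify X)"
proof -
  have add: "root_dual i (M + N) = root_dual i M + root_dual i N" if "i \<in> {1..14}" for i M N
  proof -
    have "\<forall>i\<in>{1..14}. root_dual i (M + N) = root_dual i M + root_dual i N"
      unfolding atLeastAtMost_14
      by (simp add: root_dual_def H_coord_def re_coord_def im_coord_def coef_add
          add_divide_distrib diff_divide_distrib distrib_left right_diff_distrib del: One_nat_def)
    with that show ?thesis by blast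
  qed
  have scl: "root_dual i (cscale c M) = c * root_dual i M" if "i \<in> {1..14}" for i c M
  proof -
    have "\<forall>i\<in>{1..14}. root_dual i (cscale c M) = c * root_dual i M"
      unfolding atLeastAtMost_14
      by (simp add: root_dual_def H_coord_def re_coord_def im_coord_def coef_complex
          del: One_nat_def) (simp add: algebra_simps)
    with that show ?thesis by blast
  qed
  have "cmat.representation (root_vec ` {1..14})
     (\<Sum>j=1..14. cscale (root_dual j (complexify X)) (root_vec j)) (root_vec k)
     = root_dual k (complexify X)"
    by (rule cmat.representation_image_dual[where d = root_dual])
      (use assms(2) add scl root_dual_root_vec in auto)
  then show ?thesis using root_expansion[OF assms(1)] by (simp add: root_basis_eq)
qed

section \<open>The metric in real coordinates\<close>

definition g_form :: "(nat \<Rightarrow> real) \<Rightarrow> mat7 \<Rightarrow> mat7 \<Rightarrow> real" where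
  "g_form l X Y = l 0 * (\<Sum>i=1..2. H_coord i X * H_coord i Y) +
     (\<Sum>j=1..6. l j * (re_coord j X * re_coord j Y + im_coord j X * im_coord j Y)) / 2"

text \<open>With coordinates (p - iq) / 2 and (p + iq) / 2 along a conjugate pair, the imaginary
  parts of the two products cancel and the real parts add up to (p p' + q q') / 2.\<close>

lemma g_hat_eq:
  assumes "X \<in> annih" "Y \<in> annih"
  shows "g_hat l (complexify X) (complexify Y) = of_real (g_form l X Y)"
proof -
  have H_coord: "H_coord i (complexify Z) = of_real (H_coord i Z)" if "i \<in> {1..2}" for i Z
  proof -
    have "i = 1 \<or> i = 2" using that by auto
    then show ?thesis by (auto simp add: H_coord_def coef_complex simp del: One_nat_def)
  qed
  have i6: "i = 1 \<or> i = 2 \<or> i = 3 \<or> i = 4 \<or> i = 5 \<or> i = 6" if "i \<in> {1..6::nat}" for i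
    using that by auto
  have re_coord: "re_coord i (complexify Z) = of_real (re_coord i Z)" if "i \<in> {1..6}" for i Z
    using i6[OF that] by (auto simp add: re_coord_def coef_complex simp del: One_nat_def)
  have im_coord: "im_coord i (complexify Z) = of_real (im_coord i Z)" if "i \<in> {1..6}" for i Z
    using i6[OF that] by (auto simp add: im_coord_def coef_complex simp del: One_nat_def)
  have H: "coord (complexify Z) (H_root i) = of_real (H_coord i Z)"
      if "i \<in> {1..2}" "Z \<in> annih" for i Z
    using coord_root_vec[OF that(2), of i] that H_coord[of i]
    by (simp add: root_vec_def root_dual_def)
  have E: "coord (complexify Z) (E_root i) =
      (of_real (re_coord i Z) - \<i> * of_real (im_coord i Z)) / 2"
    if "i \<in> {1..6}" "Z \<in> annih" for i Z
    using coord_root_vec[OF that(2), of "i + 2"] that re_coord[of i] im_coord[of i]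
    by (simp add: root_vec_def root_dual_def)
  have C: "coord (complexify Z) (E_root_conj i) =
      (of_real (re_coord i Z) + \<i> * of_real (im_coord i Z)) / 2"
    if "i \<in> {1..6}" "Z \<in> annih" for i Z
    using coord_root_vec[OF that(2), of "i + 8"] that re_coord[of i] im_coord[of i]
    by (simp add: root_vec_def root_dual_def)
  have "(\<Sum>j=1..6. of_real (l j) *
        (cnj (coord (complexify X) (E_root j)) * coord (complexify Y) (E_root j) +
         cnj (coord (complexify X) (E_root_conj j)) * coord (complexify Y) (E_root_conj j)))
     = (\<Sum>j=1..6. complex_of_real
         (l j * (re_coord j X * re_coord j Y + im_coord j X * im_coord j Y) / 2))"
    by (intro sum.cong refl) (simp add: E C assms, simp add: field_simps)
  moreover have "(\<Sum>i=1..2. cnj (coord (complexify X) (H_root i)) * coord (complexify Y) (H_root i))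
     = (\<Sum>i=1..2. complex_of_real (H_coord i X * H_coord i Y))"
    by (intro sum.cong refl) (simp add: H assms)
  ultimately show ?thesis
    by (simp add: g_hat_def g_form_def sum_divide_distrib)
qed

lemma sum_6: "(\<Sum>j=1..6. f j) = f 1 + f 2 + f 3 + f 4 + f 5 + f (6::nat)"
  by (simp add: numeral_eq_Suc atLeastAtMostSuc_conv ac_simps)

lemma sum_1_2: "(\<Sum>j=1..2. f j) = f 1 + f (2::nat)"
  by (simp add: numeral_eq_Suc atLeastAtMostSuc_conv ac_simps)

lemmas g_form_expand = g_form_def sum_6 sum_1_2 H_coord_def re_coord_def im_coord_def

text \<open>\<J> sends H_1 to H_2, and each E_j is an eigenvector for i. So it acts by a quarter
  turn on (x_1, x_2) and on every (p_j, q_j), and each such plane carries a single weight.\<close>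

lemma g_form_Jlin: "g_form l (Jlin X) (Jlin Y) = g_form l X Y"
proof -
  have h: "H_coord 1 (Jlin X) = - H_coord 2 X" "H_coord 2 (Jlin X) = H_coord 1 X" for X
    by (simp_all add: H_coord_def coef_Jlin field_simps del: One_nat_def)
  have p: "re_coord j (Jlin X) = im_coord j X" and q: "im_coord j (Jlin X) = - re_coord j X"
      if "j \<in> {1, 2, 3, 4, 5, 6}" for j X
    using that by (auto simp: re_coord_def im_coord_def coef_Jlin field_simps simp del: One_nat_def)
  show ?thesis unfolding g_form_def sum_6 sum_1_2
    by (simp add: h p q algebra_simps del: One_nat_def)
qed

lemma g_form_sym: "g_form l X Y = g_form l Y X"
  by (simp add: g_form_def algebra_simps)

lemma bilinear_g_form: "bilinear (g_form l)"
proof -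
  have "linear (g_form l X)" for X
    by (rule linearI)
      (simp_all add: g_form_expand coef_simps del: One_nat_def, simp_all add: field_simps)
  then show ?thesis unfolding bilinear_def using g_form_sym[of l] by simp
qed

text \<open>A sum of squares with positive weights vanishes only if all root coordinates do; these
  determine the fourteen coefficients, and thereby an element of \<open>annih\<close>.\<close>

lemma g_form_pos:
  assumes l: "\<forall>j\<le>6. l j > 0" and X: "X \<in> annih" "X \<noteq> 0"
  shows "g_form l X X > 0"
proof -
  have l': "l 0 > 0" "\<And>j. j \<in> {1..6} \<Longrightarrow> l j > 0" using l by auto
  have nn: "0 \<le> l 0 * (\<Sum>i=1..2. (H_coord i X)\<^sup>2)"
     "0 \<le> (\<Sum>j=1..6. l j * ((re_coord j X)\<^sup>2 + (im_coord j X)\<^sup>2))"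
    using l' by (auto intro!: mult_nonneg_nonneg sum_nonneg simp: less_imp_le)
  have eq: "g_form l X X = l 0 * (\<Sum>i=1..2. (H_coord i X)\<^sup>2)
      + (\<Sum>j=1..6. l j * ((re_coord j X)\<^sup>2 + (im_coord j X)\<^sup>2)) / 2"
    by (simp add: g_form_def power2_eq_square)
  have "g_form l X X \<noteq> 0"
  proof
    assume "g_form l X X = 0"
    then have z: "l 0 * (\<Sum>i=1..2. (H_coord i X)\<^sup>2) = 0"
      "(\<Sum>j=1..6. l j * ((re_coord j X)\<^sup>2 + (im_coord j X)\<^sup>2)) = 0"
      using eq nn by linarith+
    have h: "H_coord 1 X = 0 \<and> H_coord 2 X = 0"
      using z(1) l'(1) unfolding sum_1_2 by (simp add: sum_power2_eq_zero_iff)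
    have "\<forall>j\<in>{1..6}. l j * ((re_coord j X)\<^sup>2 + (im_coord j X)\<^sup>2) = 0"
      using z(2) l'(2)
      by (subst (asm) sum_nonneg_eq_0_iff) (auto intro!: mult_nonneg_nonneg simp: less_imp_le)
    then have "l j * ((re_coord j X)\<^sup>2 + (im_coord j X)\<^sup>2) = 0" if "j \<in> {1..6}" for j
      using that by blast
    with l'(2) have pq: "re_coord j X = 0 \<and> im_coord j X = 0" if "j \<in> {1..6}" for j
      using that by (force simp: sum_power2_eq_zero_iff)
    have "\<forall>k\<in>{1..14}. coef k X = 0"
      using h pq[of 1] pq[of 2] pq[of 3] pq[of 4] pq[of 5] pq[of 6]
      unfolding atLeastAtMost_14 by (simp add: H_coord_def re_coord_def im_coord_def)
    then have "g2_proj X = 0" by (simp add: g2_proj_def)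
    with X annih_eq_proj show False by simp
  qed
  moreover have "g_form l X X \<ge> 0" using eq nn by linarith
  ultimately show ?thesis by simp
qed

text \<open>The square lengths of b_1, b_5, b_14, b_3 isolate the parameters 0, 1, 2, 5; those of
  b_2, b_11, b_8 then add 3, 4, 6 through the sums with 2, 1, 5.\<close>

lemma g_form_determines:
  assumes "\<And>k. k \<in> {1..14} \<Longrightarrow> g_form m (bas k) (bas k) = g_form l (bas k) (bas k)" "j \<le> 6"
  shows "m j = l j"
proof -
  have 0: "g_form l (bas 1) (bas 1) = l 0" "g_form l (bas 5) (bas 5) = l 1 / 2"
    "g_form l (bas 14) (bas 14) = l 2 / 2" "g_form l (bas 2) (bas 2) = (l 2 + l 3) / 8"
    "g_form l (bas 11) (bas 11) = (l 1 + l 4) / 8" "g_form l (bas 3) (bas 3) = l 5 / 2"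
    "g_form l (bas 8) (bas 8) = (l 5 + l 6) / 8" for l
    by (simp_all add: g_form_expand coef_bas del: One_nat_def)
  have "m 0 = l 0" "m 1 = l 1" "m 2 = l 2" "m 3 = l 3" "m 4 = l 4" "m 5 = l 5" "m 6 = l 6"
    using assms(1)[of 1] assms(1)[of 5] assms(1)[of 14] assms(1)[of 2] assms(1)[of 11]
      assms(1)[of 3] assms(1)[of 8] unfolding 0 by simp_all
  moreover have "j = 0 \<or> j = 1 \<or> j = 2 \<or> j = 3 \<or> j = 4 \<or> j = 5 \<or> j = 6" using assms(2) by auto
  ultimately show ?thesis by auto
qed

subsection \<open>The group and its tangent spaces\<close>

text \<open>By the contraction identity, the coordinate \<open>k\<close> of \<open>q\<^sup>-\<^sup>1 x\<close> is one sixth of the sum over \<open>i\<close>, \<open>j\<close> of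
  \<open>\<phi>(q\<^sup>-\<^sup>1 x, e\<^sub>i, e\<^sub>j) \<phi>(e\<^sub>k, e\<^sub>i, e\<^sub>j)\<close>, and invariance replaces the first factor by \<open>\<phi>(x, q e\<^sub>i, q e\<^sub>j)\<close>.\<close>

definition G2_inv_bilin :: "mat7 \<Rightarrow> mat7 \<Rightarrow> mat7" where
  "G2_inv_bilin p q = (\<chi> k l. (\<Sum>i\<in>UNIV. \<Sum>j\<in>UNIV.
     phi (axis l 1) (p *v axis i 1) (q *v axis j 1) * phi (axis k 1) (axis i 1) (axis j 1)) / 6)"

definition G2_inv :: "mat7 \<Rightarrow> mat7" where
  "G2_inv q = G2_inv_bilin q q"

lemma phi_basis_sum: "(\<Sum>l\<in>UNIV. phi (axis l 1) v w * x$l) = phi x v w"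
  by (simp add: sum_7 phi_def e3_expand axis_def algebra_simps)

lemma G2_inv_left:
  assumes "q \<in> G2" shows "G2_inv q ** q = mat 1"
proof -
  have "(G2_inv q ** q) $ k $ m = mat 1 $ k $ m" for k m
  proof -
    let ?e = "\<lambda>i::7. axis i 1 :: real^7"
    have "(G2_inv q ** q) $ k $ m =
        (\<Sum>l\<in>UNIV. (\<Sum>i\<in>UNIV. \<Sum>j\<in>UNIV.
            phi (?e l) (q *v ?e i) (q *v ?e j) * phi (?e k) (?e i) (?e j)) / 6 * (q *v ?e m) $ l)"
      by (simp add: G2_inv_def G2_inv_bilin_def matrix_matrix_mult_def matrix_vector_mult_basis
          column_def)
    also have "\<dots> = (\<Sum>l\<in>UNIV. \<Sum>i\<in>UNIV. \<Sum>j\<in>UNIV.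
        phi (?e l) (q *v ?e i) (q *v ?e j) * (q *v ?e m) $ l * phi (?e k) (?e i) (?e j)) / 6"
      by (simp add: sum_distrib_left sum_distrib_right sum_divide_distrib mult_ac)
    \<comment> \<open>Summing over \<open>l\<close> first reassembles the vector q e_m in the first
      slot of \<open>phi\<close>.\<close>
    also have "\<dots> = (\<Sum>i\<in>UNIV. \<Sum>j\<in>UNIV. \<Sum>l\<in>UNIV.
        phi (?e l) (q *v ?e i) (q *v ?e j) * (q *v ?e m) $ l * phi (?e k) (?e i) (?e j)) / 6"
      by (subst sum.swap, subst (2) sum.swap) (rule refl)
    also have "\<dots> = (\<Sum>i\<in>UNIV. \<Sum>j\<in>UNIV.
        phi (q *v ?e m) (q *v ?e i) (q *v ?e j) * phi (?e k) (?e i) (?e j)) / 6"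
      by (simp add: phi_basis_sum flip: sum_distrib_right)
    \<comment> \<open>Invariance removes \<open>q\<close> from all three slots, and the contraction
      identity cancels the 6.\<close>
    also have "\<dots> = ?e m \<bullet> ?e k"
      using assms by (simp add: G2_def phi_contraction)
    finally show ?thesis by (simp add: mat_def inner_axis_axis)
  qed
  then show ?thesis by (simp add: vec_eq_iff)
qed

lemma G2_inv_right: "q \<in> G2 \<Longrightarrow> q ** G2_inv q = mat 1"
  using G2_inv_left matrix_left_right_inverse by blast

lemma matrix_inv_eq_G2_inv:
  assumes "q \<in> G2" shows "matrix_inv q = G2_inv q"
proof -
  have "q ** matrix_inv q = mat 1"
    unfolding matrix_inv_def
    \<comment> \<open>\<open>matrix_inv\<close> is a choice; \<open>G2_inv\<close> witnesses that a
      two-sided inverse exists.\<close>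
    by (rule someI2[of _ "G2_inv q"]) (use G2_inv_left G2_inv_right assms in auto)
  then have "G2_inv q ** (q ** matrix_inv q) = G2_inv q" by simp
  then show ?thesis by (simp add: matrix_mul_assoc G2_inv_left assms)
qed

lemma G2_one: "mat 1 \<in> G2"
  by (simp add: G2_def)

lemma G2_mult: "p \<in> G2 \<Longrightarrow> q \<in> G2 \<Longrightarrow> p ** q \<in> G2"
  by (simp add: G2_def flip: matrix_vector_mul_assoc)

lemma G2_inv_closed:
  assumes "q \<in> G2" shows "G2_inv q \<in> G2"
proof -
  have q: "q *v (G2_inv q *v u) = u" for u
    by (simp add: matrix_vector_mul_assoc G2_inv_right assms)
  have "phi (G2_inv q *v u) (G2_inv q *v v) (G2_inv q *v w) = phi u v w" for u v w
  proof -
    have "phi (q *v (G2_inv q *v u)) (q *v (G2_inv q *v v)) (q *v (G2_inv q *v w))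
        = phi (G2_inv q *v u) (G2_inv q *v v) (G2_inv q *v w)"
      using assms by (simp only: G2_def mem_Collect_eq)
    then show ?thesis by (simp only: q)
  qed
  then show ?thesis by (simp add: G2_def)
qed

lemma G2_inv_mult:
  assumes "p \<in> G2" "q \<in> G2" shows "G2_inv (p ** q) = G2_inv q ** G2_inv p"
proof -
  have "(G2_inv q ** G2_inv p) ** (p ** q) = G2_inv q ** (G2_inv p ** p) ** q"
    by (simp add: matrix_mul_assoc)
  then have *: "(G2_inv q ** G2_inv p) ** (p ** q) = mat 1" by (simp add: G2_inv_left assms)
  have "G2_inv (p ** q) = (G2_inv q ** G2_inv p) ** (p ** q) ** G2_inv (p ** q)"
    unfolding * by simp
  also have "\<dots> = G2_inv q ** G2_inv p"
    by (metis G2_mult assms G2_inv_right matrix_mul_assoc matrix_mul_rid)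
  finally show ?thesis .
qed

section \<open>Product rules, and the tangent space at the identity\<close>

lemma matrix_add_rdistrib: "(A + B) ** C = A ** C + B ** (C :: 'a::semiring_1^'n^'m)"
  by (simp add: matrix_matrix_mult_def vec_eq_iff sum.distrib distrib_right)

lemma bounded_bilinear_matrix_mult: "bounded_bilinear ((**) :: mat7 \<Rightarrow> mat7 \<Rightarrow> mat7)"
  unfolding bilinear_conv_bounded_bilinear[symmetric] bilinear_def
  by (auto intro!: linearI simp: matrix_add_ldistrib matrix_add_rdistrib matrix_scalar_ac
      simp flip: scalar_matrix_assoc)

lemma bounded_bilinear_matrix_vector_mult: "bounded_bilinear ((*v) :: mat7 \<Rightarrow> real^7 \<Rightarrow> real^7)"
  unfolding bilinear_conv_bounded_bilinear[symmetric] bilinear_def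
  by (auto intro!: linearI simp: matrix_vector_right_distrib matrix_vector_mult_add_rdistrib
      matrix_vector_mult_scaleR simp flip: scaleR_matrix_vector_assoc)

lemma e3_has_derivative:
  assumes "(a has_vector_derivative a') (at t)" "(b has_vector_derivative b') (at t)"
    "(c has_vector_derivative c') (at t)"
  shows "((\<lambda>t. e3 i j k (a t) (b t) (c t)) has_real_derivative
      e3 i j k a' (b t) (c t) + e3 i j k (a t) b' (c t) + e3 i j k (a t) (b t) c') (at t)"
proof -
  have [derivative_intros]: "((\<lambda>t. f t $ i) has_real_derivative f' $ i) (at t)"
    if "(f has_vector_derivative f') (at t)" for f :: "real \<Rightarrow> real^7" and f' i
    using bounded_linear.has_vector_derivative[OF bounded_linear_vec_nth that]
    by (simp add: has_real_derivative_iff_has_vector_derivative)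
  show ?thesis unfolding e3_expand
    by (rule derivative_eq_intros assms refl)+ (simp add: algebra_simps)
qed

lemma phi_has_derivative:
  assumes "(a has_vector_derivative a') (at t)" "(b has_vector_derivative b') (at t)"
    "(c has_vector_derivative c') (at t)"
  shows "((\<lambda>t. phi (a t) (b t) (c t)) has_real_derivative
      phi a' (b t) (c t) + phi (a t) b' (c t) + phi (a t) (b t) c') (at t)"
  unfolding phi_def
  by (rule derivative_eq_intros e3_has_derivative assms refl)+ simp

lemma has_vector_derivative_mat_vec:
  assumes "(\<gamma> has_vector_derivative (\<gamma>'::mat7)) (at t)"
  shows "((\<lambda>t. \<gamma> t *v u) has_vector_derivative \<gamma>' *v u) (at t)"
  using bounded_linear.has_vector_derivative[OF
      bounded_bilinear.bounded_linear_left[OF bounded_bilinear_matrix_vector_mult] assms] .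

text \<open>Along a curve in the group \<open>phi\<close> of the moved vectors is constant, and its
  derivative at the identity is \<open>phi_deriv\<close>.\<close>

lemma tangent_one_subset_annih: "tangent_space G2 (mat 1) \<subseteq> annih"
proof
  fix X assume "X \<in> tangent_space G2 (mat 1)"
  then obtain \<gamma> where \<gamma>: "\<And>t. \<gamma> t \<in> G2" "\<gamma> 0 = mat 1" "(\<gamma> has_vector_derivative X) (at 0)"
    by (auto simp: tangent_space_def)
  have "phi_deriv X u v w = 0" for u v w
  proof -
    note d = has_vector_derivative_mat_vec[OF \<gamma>(3)]
    have "((\<lambda>t. phi (\<gamma> t *v u) (\<gamma> t *v v) (\<gamma> t *v w)) has_real_derivative phi_deriv X u v w) (at 0)"
      using phi_has_derivative[OF d d d] by (simp add: phi_deriv_def \<gamma>(2))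
    moreover have "phi (\<gamma> t *v u) (\<gamma> t *v v) (\<gamma> t *v w) = phi u v w" for t
      using \<gamma>(1) by (simp add: G2_def)
    ultimately have "((\<lambda>t. phi u v w) has_real_derivative phi_deriv X u v w) (at 0)" by simp
    then show ?thesis by (rule DERIV_unique) simp
  qed
  then show "X \<in> annih" by (simp add: annih_def)
qed

text \<open>Each basis element generates unit-speed rotations in two coordinate planes with disjoint
  indices, so its square is minus the projection onto the four coordinates involved.\<close>

lemma bas_cube:
  assumes "k \<in> {1..14}" shows "bas k ** (bas k ** bas k) = - bas k"
proof -
  have "\<forall>k\<in>{1..14}. bas k *v (bas k *v (bas k *v x)) = - (bas k *v x)" for x
    unfolding atLeastAtMost_14 vec_eq_iff forall_7
    by (simp add: bas_def matrix_vector_mult_add_rdistrib matrix_vector_mult_diff_rdistrib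
        E_skew_mult_vec)
  moreover have minus: "(- A) *v x = - (A *v x)" for A :: mat7 and x
    by (simp add: vec_eq_iff matrix_vector_mult_def sum_negf)
  ultimately have "(bas k ** (bas k ** bas k)) *v x = (- bas k) *v x" for x
    using assms by (simp add: minus flip: matrix_vector_mul_assoc)
  then show ?thesis by (simp add: matrix_eq)
qed

text \<open>The cubic relation collapses exp(tB) to Rodrigues' formula \<open>R t\<close>. The
  derivative of \<open>phi\<close> along it is \<open>phi_deriv B\<close> at moved vectors, which is
  zero, so the curve stays in the group.\<close>

lemma rotation_generator_tangent:
  assumes B: "B \<in> annih" and cube: "B ** (B ** B) = - B"
  shows "B \<in> tangent_space G2 (mat 1)"
proof -
  define R where "R t = mat 1 + sin t *\<^sub>R B + (1 - cos t) *\<^sub>R (B ** B)" for t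
  interpret bounded_bilinear "(**) :: mat7 \<Rightarrow> mat7 \<Rightarrow> mat7" by (rule bounded_bilinear_matrix_mult)
  have R': "(R has_vector_derivative B ** R t) (at t)" for t
  proof -
    have "(R has_vector_derivative (cos t *\<^sub>R B + sin t *\<^sub>R (B ** B))) (at t)"
      unfolding R_def by (rule derivative_eq_intros refl | simp)+
    moreover have "B ** R t = cos t *\<^sub>R B + sin t *\<^sub>R (B ** B)"
      unfolding R_def by (simp add: add_right diff_right scaleR_right cube algebra_simps)
    ultimately show ?thesis by simp
  qed
  have R0: "R 0 = mat 1" by (simp add: R_def)
  have "phi (R t *v u) (R t *v v) (R t *v w) = phi u v w" for t u v w
  proof -
    have "((\<lambda>t. phi (R t *v u) (R t *v v) (R t *v w)) has_real_derivative 0) (at t)" for t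
    proof -
      note d = has_vector_derivative_mat_vec[OF R']
      have "phi_deriv B (R t *v u) (R t *v v) (R t *v w) = 0" using B by (simp add: annih_def)
      then show ?thesis
        using phi_has_derivative[OF d[where u = u] d[where u = v] d[where u = w], of t]
        by (simp add: phi_deriv_def matrix_vector_mul_assoc)
    qed
    from DERIV_isconst_all[OF allI[OF this], of t 0] show ?thesis by (simp add: R0)
  qed
  then have "R t \<in> G2" for t by (simp add: G2_def)
  with R0 R'[of 0] show ?thesis unfolding tangent_space_def by auto
qed

text \<open>Sums come from pointwise products of curves, multiples from rescaling time.\<close>

lemma subspace_tangent_one: "subspace (tangent_space G2 (mat 1))"
proof (rule subspaceI)
  show "0 \<in> tangent_space G2 (mat 1)"
    unfolding tangent_space_def by (auto intro!: exI[of _ "\<lambda>t. mat 1"] G2_one)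
next
  fix X Y assume "X \<in> tangent_space G2 (mat 1)" "Y \<in> tangent_space G2 (mat 1)"
  then obtain \<gamma> \<delta> where c: "\<And>t. \<gamma> t \<in> G2" "\<gamma> 0 = mat 1" "(\<gamma> has_vector_derivative X) (at 0)"
    "\<And>t. \<delta> t \<in> G2" "\<delta> 0 = mat 1" "(\<delta> has_vector_derivative Y) (at 0)"
    by (auto simp: tangent_space_def)
  have "((\<lambda>t. \<gamma> t ** \<delta> t) has_vector_derivative X + Y) (at 0)"
    using bounded_bilinear.has_vector_derivative[OF bounded_bilinear_matrix_mult c(3,6)]
    by (simp add: c add.commute)
  then show "X + Y \<in> tangent_space G2 (mat 1)"
    unfolding tangent_space_def by (auto intro!: exI[of _ "\<lambda>t. \<gamma> t ** \<delta> t"] G2_mult simp: c)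
next
  fix a X assume "X \<in> tangent_space G2 (mat 1)"
  then obtain \<gamma> where c: "\<And>t. \<gamma> t \<in> G2" "\<gamma> 0 = mat 1" "(\<gamma> has_vector_derivative X) (at 0)"
    by (auto simp: tangent_space_def)
  have "((\<gamma> \<circ> (\<lambda>t. a * t)) has_vector_derivative a *\<^sub>R X) (at 0)"
    by (rule vector_diff_chain_at) (auto intro!: derivative_eq_intros simp: c)
  then show "a *\<^sub>R X \<in> tangent_space G2 (mat 1)"
    unfolding tangent_space_def by (auto intro!: exI[of _ "\<gamma> \<circ> (\<lambda>t. a * t)"] simp: c)
qed

lemma tangent_one_eq: "tangent_space G2 (mat 1) = annih"
proof
  show "annih \<subseteq> tangent_space G2 (mat 1)"
  proof
    fix X assume "X \<in> annih"
    then have "X = g2_proj X" by (simp add: annih_eq_proj)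
    also have "\<dots> \<in> tangent_space G2 (mat 1)"
      unfolding g2_proj_def
      by (intro subspace_sum subspace_scale subspace_tangent_one rotation_generator_tangent
          annih_bas bas_cube)
    finally show "X \<in> tangent_space G2 (mat 1)" .
  qed
qed (rule tangent_one_subset_annih)

lemma tangent_translate:
  assumes "A \<in> G2" "v \<in> tangent_space G2 p"
  shows "A ** v \<in> tangent_space G2 (A ** p)"
proof -
  obtain \<gamma> where c: "\<And>t. \<gamma> t \<in> G2" "\<gamma> 0 = p" "(\<gamma> has_vector_derivative v) (at 0)"
    using assms(2) by (auto simp: tangent_space_def)
  have "((\<lambda>t. A ** \<gamma> t) has_vector_derivative A ** v) (at 0)"
    using bounded_linear.has_vector_derivative[OF
        bounded_bilinear.bounded_linear_right[OF bounded_bilinear_matrix_mult] c(3)] .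
  then show ?thesis
    unfolding tangent_space_def by (auto intro!: exI[of _ "\<lambda>t. A ** \<gamma> t"] G2_mult assms simp: c)
qed

lemma tangent_G2_iff:
  assumes "p \<in> G2" shows "v \<in> tangent_space G2 p \<longleftrightarrow> G2_inv p ** v \<in> annih"
proof
  assume "v \<in> tangent_space G2 p"
  from tangent_translate[OF G2_inv_closed[OF assms] this] show "G2_inv p ** v \<in> annih"
    by (simp add: G2_inv_left assms tangent_one_eq)
next
  assume "G2_inv p ** v \<in> annih"
  then have "G2_inv p ** v \<in> tangent_space G2 (mat 1)" by (simp add: tangent_one_eq)
  from tangent_translate[OF assms this] show "v \<in> tangent_space G2 p"
    by (simp add: matrix_mul_assoc G2_inv_right assms)
qed

lemma tangent_G2_mult:
  assumes "p \<in> G2" "X \<in> annih" shows "p ** X \<in> tangent_space G2 p"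
  using assms by (simp add: tangent_G2_iff matrix_mul_assoc G2_inv_left)

subsection \<open>Smooth maps\<close>

lemma Ck_on_subset: "Ck_on k U f \<Longrightarrow> U' \<subseteq> U \<Longrightarrow> Ck_on k U' f"
  by (induction k arbitrary: f) (auto intro: continuous_on_subset differentiable_on_subset)

lemma Ck_on_has_derivative:
  assumes "Ck_on (Suc k) U f" "open U" "x \<in> U"
  shows "(f has_derivative frechet_derivative f (at x)) (at x)"
  using assms by (simp add: differentiable_on_eq_differentiable_at frechet_derivative_works)

lemma Ck_on_SucI:
  assumes "open U" "\<And>x. x \<in> U \<Longrightarrow> (f has_derivative D x) (at x)"
    and "\<And>v. Ck_on k U (\<lambda>x. frechet_derivative f (at x) v)"
  shows "Ck_on (Suc k) U f"
proof -
  have "f differentiable at x" if "x \<in> U" for x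
    using assms(2)[OF that] by (rule differentiableI)
  then show ?thesis
    using assms(1,3) by (simp add: differentiable_on_eq_differentiable_at)
qed

text \<open>On an open set, functions that agree also have equal derivatives; the induction passes
  this on to all orders.\<close>

lemma Ck_on_cong:
  assumes "open U" "\<And>x. x \<in> U \<Longrightarrow> f x = g x"
  shows "Ck_on k U f \<longleftrightarrow> Ck_on k U g"
  using assms(2)
proof (induction k arbitrary: f g)
  case 0
  then show ?case by (simp cong: continuous_on_cong)
next
  case (Suc k)
  have *: "Ck_on (Suc k) U g"
    if f: "Ck_on (Suc k) U f" and eq: "\<And>x. x \<in> U \<Longrightarrow> f x = g x" for f g :: "'a \<Rightarrow> 'b"
  proof (rule Ck_on_SucI[OF assms(1)])
    have d: "(g has_derivative frechet_derivative f (at x)) (at x)" if "x \<in> U" for x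
      by (rule has_derivative_transform_within_open[OF Ck_on_has_derivative[OF f assms(1) that]
          assms(1) that])
        (rule eq)
    show "(g has_derivative frechet_derivative f (at x)) (at x)" if "x \<in> U" for x
      by (rule d[OF that])
    show "Ck_on k U (\<lambda>x. frechet_derivative g (at x) v)" for v
    proof -
      have "Ck_on k U (\<lambda>x. frechet_derivative f (at x) v)" using f by simp
      moreover have "frechet_derivative f (at x) v = frechet_derivative g (at x) v" if "x \<in> U" for x
        by (rule fun_cong[OF frechet_derivative_at[OF d[OF that]]])
      ultimately show ?thesis
        by (rule iffD1[OF Suc.IH, rotated])
    qed
  qed
  show ?case
  proof
    show "Ck_on (Suc k) U g" if "Ck_on (Suc k) U f" by (rule *[OF that Suc.prems])
    show "Ck_on (Suc k) U f" if "Ck_on (Suc k) U g" by (rule *[OF that]) (simp add: Suc.prems)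
  qed
qed

text \<open>Uniqueness of the derivative lets a known formula \<open>D\<close> stand for the chosen
  \<open>frechet_derivative\<close>, as the closure rules below require.\<close>

lemma Ck_on_SucI_explicit:
  assumes U: "open U" and d: "\<And>x. x \<in> U \<Longrightarrow> (f has_derivative D x) (at x)"
    and "\<And>v. Ck_on k U (\<lambda>x. D x v)"
  shows "Ck_on (Suc k) U f"
proof (rule Ck_on_SucI[OF U d])
  show "Ck_on k U (\<lambda>x. frechet_derivative f (at x) v)" for v
    using Ck_on_cong[OF U, of "\<lambda>x. frechet_derivative f (at x) v" "\<lambda>x. D x v"]
      frechet_derivative_at[OF d] assms(3) by metis
qed

lemma Ck_on_SucD: "Ck_on (Suc k) U f \<Longrightarrow> Ck_on k U f"
  by (induction k arbitrary: f) (auto intro: differentiable_imp_continuous_on)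

lemma Ck_on_const: "open U \<Longrightarrow> Ck_on k U (\<lambda>x. c)"
proof (induction k arbitrary: c)
  case (Suc k)
  show ?case by (rule Ck_on_SucI_explicit[OF Suc.prems has_derivative_const]) (simp add: Suc)
qed simp

lemma Ck_on_ident: "open U \<Longrightarrow> Ck_on k U (\<lambda>x. x)"
  by (cases k) (auto intro!: Ck_on_SucI_explicit[OF _ has_derivative_ident] Ck_on_const
      simp del: Ck_on.simps(2))

lemma Ck_on_add:
  "open U \<Longrightarrow> Ck_on k U f \<Longrightarrow> Ck_on k U g \<Longrightarrow> Ck_on k U (\<lambda>x. f x + g x)"
proof (induction k arbitrary: f g)
  case (Suc k)
  show ?case
    by (rule Ck_on_SucI_explicit[OF Suc.prems(1) has_derivative_add[OF
          Ck_on_has_derivative[OF Suc.prems(2,1)] Ck_on_has_derivative[OF Suc.prems(3,1)]]])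
      (use Suc in auto)
qed (simp add: continuous_on_add)

lemma Ck_on_bounded_linear:
  assumes "bounded_linear L"
  shows "open U \<Longrightarrow> Ck_on k U f \<Longrightarrow> Ck_on k U (\<lambda>x. L (f x))"
proof (induction k arbitrary: f)
  case (Suc k)
  show ?case
    by (rule Ck_on_SucI_explicit[OF Suc.prems(1) bounded_linear.has_derivative[OF assms
          Ck_on_has_derivative[OF Suc.prems(2,1)]]])
      (use Suc in auto)
qed (simp add: bounded_linear.continuous_on[OF assms])

lemma Ck_on_bounded_bilinear:
  assumes "bounded_bilinear h"
  shows "open U \<Longrightarrow> Ck_on k U f \<Longrightarrow> Ck_on k U g \<Longrightarrow> Ck_on k U (\<lambda>x. h (f x) (g x))"
proof (induction k arbitrary: f g)
  case (Suc k)
  show ?case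
  proof (rule Ck_on_SucI_explicit[OF Suc.prems(1) bounded_bilinear.FDERIV[OF assms
          Ck_on_has_derivative[OF Suc.prems(2,1)] Ck_on_has_derivative[OF Suc.prems(3,1)]]])
    show "Ck_on k U (\<lambda>x. h (f x) (frechet_derivative g (at x) v)
        + h (frechet_derivative f (at x) v) (g x))" for v
      \<comment> \<open>The product rule retains undifferentiated factors, so their regularity is
        lowered by one order.\<close>
      using Suc.prems Ck_on_SucD[OF Suc.prems(2)] Ck_on_SucD[OF Suc.prems(3)]
      by (intro Ck_on_add Suc.IH) auto
  qed
qed (simp add: bounded_bilinear.continuous_on[OF assms])

lemma smooth_on_ident: "open U \<Longrightarrow> smooth_on U (\<lambda>x. x)"
  by (simp add: smooth_on_def Ck_on_ident)

lemma smooth_on_bounded_linear: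
  "bounded_linear L \<Longrightarrow> smooth_on U f \<Longrightarrow> smooth_on U (\<lambda>x. L (f x))"
  by (simp add: smooth_on_def Ck_on_bounded_linear)

lemma smooth_on_bounded_bilinear:
  "bounded_bilinear h \<Longrightarrow> smooth_on U f \<Longrightarrow> smooth_on U g \<Longrightarrow> smooth_on U (\<lambda>x. h (f x) (g x))"
  by (simp add: smooth_on_def Ck_on_bounded_bilinear)

lemma smooth_on_subset: "smooth_on U f \<Longrightarrow> open U' \<Longrightarrow> U' \<subseteq> U \<Longrightarrow> smooth_on U' f"
  by (auto simp: smooth_on_def intro: Ck_on_subset)

lemma smooth_on_has_derivative:
  "smooth_on U f \<Longrightarrow> x \<in> U \<Longrightarrow> (f has_derivative frechet_derivative f (at x)) (at x)"
  unfolding smooth_on_def using Ck_on_has_derivative by blast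

text \<open>Both functions coincide along a curve in \<open>G\<close> with velocity
  \<open>v\<close>, and the chain rule compares the derivatives. Identities valid only on
  \<open>G\<close> can thus be differentiated in tangent directions, whatever the
  extensions.\<close>

lemma derivative_eq_on_tangent:
  assumes f: "(f has_derivative f') (at p)" and g: "(g has_derivative g') (at p)"
    and eq: "\<And>q. q \<in> G \<Longrightarrow> f q = g q" and v: "v \<in> tangent_space G p"
  shows "f' v = g' v"
proof -
  obtain \<gamma> :: "real \<Rightarrow> 'a" where \<gamma>: "\<And>t. \<gamma> t \<in> G" "\<gamma> 0 = p" "(\<gamma> has_vector_derivative v) (at 0)"
    using v by (auto simp: tangent_space_def)
  have chain: "((\<lambda>t. h (\<gamma> t)) has_vector_derivative h' v) (at 0)"
    if "(h has_derivative h') (at p)" for h :: "'a \<Rightarrow> 'b" and h'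
  proof -
    have "((\<lambda>t. h (\<gamma> t)) has_derivative (\<lambda>t. h' (t *\<^sub>R v))) (at 0)"
      by (rule has_derivative_compose) (use \<gamma> that in \<open>auto simp: has_vector_derivative_def\<close>)
    then show ?thesis
      using linear_scale[OF has_derivative_linear[OF that]] by (simp add: has_vector_derivative_def)
  qed
  have "(\<lambda>t. f (\<gamma> t)) = (\<lambda>t. g (\<gamma> t))" using eq \<gamma>(1) by auto
  then show ?thesis using vector_derivative_unique_at[OF chain[OF f]] chain[OF g] by simp
qed

text \<open>Separating the two occurrences of \<open>q\<close> makes the quadratic inverse the
  diagonal of a bilinear map, to which \<open>smooth_on_bounded_bilinear\<close> applies.\<close>

lemma bounded_bilinear_G2_inv_bilin: "bounded_bilinear G2_inv_bilin"
  unfolding bilinear_conv_bounded_bilinear[symmetric] bilinear_def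
  using phi_linear[where a = 1 and b = 1] phi_linear[where b = 0]
  by (auto intro!: linearI simp: G2_inv_bilin_def vec_eq_iff matrix_vector_mult_add_rdistrib
      sum.distrib distrib_right add_divide_distrib sum_distrib_left mult.assoc sum_divide_distrib
      simp flip: scaleR_matrix_vector_assoc)

section \<open>Left trivialisation of vector fields\<close>

definition left_triv :: "(mat7 \<Rightarrow> mat7) \<Rightarrow> mat7 \<Rightarrow> mat7" where
  "left_triv V q = G2_inv q ** V q"

text \<open>Off the group \<open>G2_inv\<close> is still a polynomial, so no smoothness is lost on
  the neighbourhood.\<close>

lemma smooth_on_left_triv: "smooth_on U V \<Longrightarrow> smooth_on U (left_triv V)"
  unfolding left_triv_def[abs_def] G2_inv_def
  by (intro smooth_on_bounded_bilinear[OF bounded_bilinear_matrix_mult]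
      smooth_on_bounded_bilinear[OF bounded_bilinear_G2_inv_bilin] smooth_on_ident)
          (auto simp: smooth_on_def)

lemma mult_left_triv: "q \<in> G2 \<Longrightarrow> q ** left_triv V q = V q"
  by (simp add: left_triv_def matrix_mul_assoc G2_inv_right)

lemma left_triv_annih: "vector_field G2 V \<Longrightarrow> q \<in> G2 \<Longrightarrow> left_triv V q \<in> annih"
  by (auto simp: vector_field_def left_triv_def tangent_G2_iff)

lemma vector_field_has_derivative:
  assumes "vector_field G2 V" "p \<in> G2"
  shows "(V has_derivative frechet_derivative V (at p)) (at p)"
    "(left_triv V has_derivative frechet_derivative (left_triv V) (at p)) (at p)"
proof -
  obtain U where U: "G2 \<subseteq> U" "smooth_on U V" using assms(1) by (auto simp: vector_field_def)
  with assms(2) show "(V has_derivative frechet_derivative V (at p)) (at p)"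
    "(left_triv V has_derivative frechet_derivative (left_triv V) (at p)) (at p)"
    by (auto intro!: smooth_on_has_derivative[of U] smooth_on_left_triv)
qed

lemma linear_has_derivative:
  fixes L :: "'a::euclidean_space \<Rightarrow> 'b::real_normed_vector"
  shows "linear L \<Longrightarrow> (f has_derivative f') F \<Longrightarrow> ((\<lambda>x. L (f x)) has_derivative (\<lambda>v. L (f' v))) F"
  by (simp add: bounded_linear.has_derivative linear_linear)

text \<open>On the group the trivialised field agrees with its \<open>g2_proj\<close>;
  differentiating this identity in a tangent direction shows that the derivative is fixed by the
  projection.\<close>

lemma left_triv_derivative_annih:
  assumes V: "vector_field G2 V" and p: "p \<in> G2" and x: "x \<in> tangent_space G2 p"
  shows "frechet_derivative (left_triv V) (at p) x \<in> annih"
proof -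
  note d = vector_field_has_derivative(2)[OF V p]
  have "frechet_derivative (left_triv V) (at p) x
      = g2_proj (frechet_derivative (left_triv V) (at p) x)"
    by (rule derivative_eq_on_tangent[OF d linear_has_derivative[OF linear_g2_proj d] _ x])
      (simp add: annih_eq_proj left_triv_annih V)
  then show ?thesis using g2_proj_annih by metis
qed

text \<open>The product rule for V(q) = q v(q), an identity on the group only, hence the restriction
  to tangent directions.\<close>

lemma field_derivative:
  assumes V: "vector_field G2 V" and p: "p \<in> G2" and x: "x \<in> tangent_space G2 p"
  shows "frechet_derivative V (at p) x = p ** frechet_derivative (left_triv V) (at p) x
      + x ** left_triv V p"
  by (rule derivative_eq_on_tangent[OF vector_field_has_derivative(1)[OF V p]
        bounded_bilinear.FDERIV[OF bounded_bilinear_matrix_mult has_derivative_ident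
          vector_field_has_derivative(2)[OF V p]] _ x])
    (simp add: mult_left_triv)

text \<open>The undifferentiated terms of the product rule combine to the commutator, because V(p)
  w(p) = p v(p) w(p).\<close>

lemma lie_bracket_left_triv:
  assumes V: "vector_field G2 V" and W: "vector_field G2 W" and p: "p \<in> G2"
  shows "lie_bracket V W p = p ** (comm (left_triv V p) (left_triv W p)
     + frechet_derivative (left_triv W) (at p) (V p)
     - frechet_derivative (left_triv V) (at p) (W p))"
proof -
  interpret bounded_bilinear "(**) :: mat7 \<Rightarrow> mat7 \<Rightarrow> mat7" by (rule bounded_bilinear_matrix_mult)
  have t: "V p \<in> tangent_space G2 p" "W p \<in> tangent_space G2 p" using V W p
    by (auto simp: vector_field_def)
  have "V p ** left_triv W p = p ** (left_triv V p ** left_triv W p)"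
    "W p ** left_triv V p = p ** (left_triv W p ** left_triv V p)"
    by (simp_all add: matrix_mul_assoc mult_left_triv p)
  then show ?thesis
    by (simp add: lie_bracket_def field_derivative[OF W p t(1)] field_derivative[OF V p t(2)]
        comm_def add_right diff_right algebra_simps)
qed

subsection \<open>The left-invariant Hermitian structure\<close>

abbreviation "J_field \<equiv> left_translate_endo samelson"

lemma J_field_eq:
  assumes "p \<in> G2" "v \<in> tangent_space G2 p"
  shows "J_field p v = p ** Jlin (G2_inv p ** v)"
  using assms by (simp add: left_translate_endo_def matrix_inv_eq_G2_inv samelson_eq_Jlin
      tangent_G2_iff)

lemma J_field_mult:
  assumes "p \<in> G2" "X \<in> annih" shows "J_field p (p ** X) = p ** Jlin X"
  using assms by (simp add: J_field_eq tangent_G2_mult matrix_mul_assoc G2_inv_left)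

lemma almost_complex_J_field: "almost_complex_structure G2 J_field"
  unfolding almost_complex_structure_def
proof (intro conjI ballI allI impI)
  interpret bounded_bilinear "(**) :: mat7 \<Rightarrow> mat7 \<Rightarrow> mat7" by (rule bounded_bilinear_matrix_mult)
  fix p v assume p: "p \<in> G2" and v: "v \<in> tangent_space G2 p"
  have form: "\<exists>X\<in>annih. w = p ** X" if "w \<in> tangent_space G2 p" for w
    using that p by (intro bexI[of _ "G2_inv p ** w"])
      (simp_all add: matrix_mul_assoc G2_inv_right tangent_G2_iff)
  from form[OF v] obtain X where X: "X \<in> annih" "v = p ** X" by blast
  show "J_field p v \<in> tangent_space G2 p"
    by (simp add: X J_field_mult p tangent_G2_mult Jlin_annih)
  show "J_field p (J_field p v) = - v"
    by (simp add: X J_field_mult p Jlin_annih Jlin_Jlin minus_right)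
  show "J_field p (a *\<^sub>R v) = a *\<^sub>R J_field p v" for a
    using J_field_mult[OF p subspace_scale[OF annih_subspace X(1), of a]]
    by (simp add: X J_field_mult p scaleR_right linear_scale[OF linear_Jlin])
  show "J_field p (v + w) = J_field p v + J_field p w" if "w \<in> tangent_space G2 p" for w
  proof -
    from form[OF that] obtain Y where Y: "Y \<in> annih" "w = p ** Y" by blast
    show ?thesis
      using J_field_mult[OF p subspace_add[OF annih_subspace X(1) Y(1)]]
      by (simp add: X Y J_field_mult p add_right linear_add[OF linear_Jlin])
  qed
next
  fix V assume V: "vector_field G2 V"
  then obtain U where U: "G2 \<subseteq> U" "smooth_on U V" by (auto simp: vector_field_def)
  \<comment> \<open>An extension of the rotated field: \<open>G2_inv\<close> and \<open>Jlin\<close>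
    replace \<open>matrix_inv\<close> and \<open>samelson\<close>, which they equal where it matters
    and which need not vary smoothly off the group.\<close>
  let ?V = "\<lambda>q. q ** Jlin (left_triv V q)"
  have "open U" using U(2) by (simp add: smooth_on_def)
  have "bounded_linear Jlin" by (simp add: linear_Jlin linear_linear)
  from smooth_on_bounded_linear[OF this smooth_on_left_triv[OF U(2)]] have "smooth_on U ?V"
    by (rule smooth_on_bounded_bilinear[OF bounded_bilinear_matrix_mult
        smooth_on_ident[OF \<open>open U\<close>]])
  then have "vector_field G2 ?V"
    using U(1) by (auto simp: vector_field_def tangent_G2_mult Jlin_annih)
  moreover have "?V p = J_field p (V p)" if "p \<in> G2" for p
    using V that by (simp add: J_field_eq vector_field_def left_triv_def)
  ultimately show "\<exists>V'. vector_field G2 V' \<and> (\<forall>p\<in>G2. V' p = J_field p (V p))" by blast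
qed

lemma integrable_J_field: "integrable_structure G2 J_field"
  unfolding integrable_structure_def
proof (intro allI impI ballI)
  fix V W V' W' p
  assume *: "vector_field G2 V \<and> vector_field G2 W \<and> vector_field G2 V' \<and> vector_field G2 W' \<and>
    (\<forall>p\<in>G2. V' p = J_field p (V p) \<and> W' p = J_field p (W p))" and p: "p \<in> G2"
  then have f: "vector_field G2 V" "vector_field G2 W" "vector_field G2 V'" "vector_field G2 W'"
    and J: "\<And>q. q \<in> G2 \<Longrightarrow> V' q = J_field q (V q)" "\<And>q. q \<in> G2 \<Longrightarrow> W' q = J_field q (W q)" by auto
  interpret bounded_bilinear "(**) :: mat7 \<Rightarrow> mat7 \<Rightarrow> mat7" by (rule bounded_bilinear_matrix_mult)
  have left_trivJ: "left_triv V' q = Jlin (left_triv V q)" "left_triv W' q = Jlin (left_triv W q)"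
      if "q \<in> G2" for q
    using that f J[OF that]
    by (simp_all add: left_triv_def J_field_eq vector_field_def matrix_mul_assoc G2_inv_left)
  let ?D = "\<lambda>V. frechet_derivative (left_triv V) (at p)"
  have t: "V p \<in> tangent_space G2 p" "W p \<in> tangent_space G2 p"
    "V' p \<in> tangent_space G2 p" "W' p \<in> tangent_space G2 p"
    using f p by (auto simp: vector_field_def)
  \<comment> \<open>The extension of V' is arbitrary and tied to that of V on the group alone, so
    derivatives are compared only along tangent vectors.\<close>
  have DV': "?D V' x = Jlin (?D V x)" if "x \<in> tangent_space G2 p" for x
    by (rule derivative_eq_on_tangent[OF vector_field_has_derivative(2)[OF f(3) p]
        linear_has_derivative[OF linear_Jlin vector_field_has_derivative(2)[OF f(1) p]]
        left_trivJ(1) that])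
  have DW': "?D W' x = Jlin (?D W x)" if "x \<in> tangent_space G2 p" for x
    by (rule derivative_eq_on_tangent[OF vector_field_has_derivative(2)[OF f(4) p]
        linear_has_derivative[OF linear_Jlin vector_field_has_derivative(2)[OF f(2) p]]
        left_trivJ(2) that])
  define v w where "v = left_triv V p" and "w = left_triv W p"
  have vw: "v \<in> annih" "w \<in> annih" by (simp_all add: v_def w_def left_triv_annih f p)
  define A B C D where "A = ?D W (V' p)" and "B = ?D V (W' p)"
    and "C = ?D W (V p)" and "D = ?D V (W p)"
  have ABCD: "A \<in> annih" "B \<in> annih" "C \<in> annih" "D \<in> annih"
    unfolding A_def B_def C_def D_def by (intro left_triv_derivative_annih f p t)+
  note br = lie_bracket_left_triv[OF _ _ p]
  have b: "lie_bracket V' W' p = p ** (comm (Jlin v) (Jlin w) + Jlin A - Jlin B)"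
    "lie_bracket V' W p = p ** (comm (Jlin v) w + A - Jlin D)"
    "lie_bracket V W' p = p ** (comm v (Jlin w) + Jlin C - B)"
    "lie_bracket V W p = p ** (comm v w + C - D)"
    by (simp_all add: br f DV' DW' t left_trivJ p A_def B_def C_def D_def v_def w_def)
  note s = subspace_add[OF annih_subspace] subspace_diff[OF annih_subspace]
  \<comment> \<open>Here \<open>Jlin_Jlin\<close> turns the images of - Jlin D and Jlin C into D and
    - C.\<close>
  have JJ: "J_field p (lie_bracket V' W p) = p ** (Jlin (comm (Jlin v) w) + Jlin A + D)"
    "J_field p (lie_bracket V W' p) = p ** (Jlin (comm v (Jlin w)) - C - Jlin B)"
    unfolding b using vw ABCD
    by (simp_all add: J_field_mult p s comm_annih Jlin_annih Jlin_Jlin linear_add[OF linear_Jlin]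
        linear_diff[OF linear_Jlin])
  \<comment> \<open>The terms with A, B, C and D each occur twice with opposite signs.\<close>
  have "lie_bracket V' W' p - J_field p (lie_bracket V' W p) - J_field p (lie_bracket V W' p)
      - lie_bracket V W p
      = p ** (comm (Jlin v) (Jlin w) - Jlin (comm (Jlin v) w) - Jlin (comm v (Jlin w)) - comm v w)"
    unfolding JJ unfolding b by (simp add: add_right diff_right algebra_simps)
  also have "\<dots> = 0" by (simp only: samelson_nijenhuis[OF vw] zero_right)
  finally show "lie_bracket V' W' p - J_field p (lie_bracket V' W p)
      - J_field p (lie_bracket V W' p) - lie_bracket V W p = 0" .
qed

lemma G2_inv_translate:
  assumes "A \<in> G2" "F \<in> G2" shows "G2_inv (A ** F) ** (A ** v) = G2_inv F ** v"
proof -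
  have "G2_inv F ** G2_inv A ** (A ** v) = G2_inv F ** (G2_inv A ** A) ** v"
    by (simp add: matrix_mul_assoc)
  then show ?thesis by (simp add: G2_inv_mult G2_inv_left assms)
qed

lemma left_invariant_J_field: "left_invariant_endo G2 J_field"
  unfolding left_invariant_endo_def
  by (simp add: J_field_eq G2_mult tangent_translate G2_inv_translate) (simp add: matrix_mul_assoc)

section \<open>The left-invariant metric\<close>

lemma g_restr_eq_g_form: "X \<in> annih \<Longrightarrow> Y \<in> annih \<Longrightarrow> g_restr l X Y = g_form l X Y"
  by (simp add: g_restr_def g_hat_eq)

lemma metric_eq:
  assumes "p \<in> G2" "v \<in> tangent_space G2 p" "w \<in> tangent_space G2 p"
  shows "left_translate_form (g_restr l) p v w = g_form l (G2_inv p ** v) (G2_inv p ** w)"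
  using assms by (simp add: left_translate_form_def matrix_inv_eq_G2_inv g_restr_eq_g_form
      tangent_G2_iff)

lemma subspace_tangent:
  assumes "p \<in> G2" shows "subspace (tangent_space G2 p)"
proof -
  interpret bounded_bilinear "(**) :: mat7 \<Rightarrow> mat7 \<Rightarrow> mat7" by (rule bounded_bilinear_matrix_mult)
  show ?thesis
    by (rule subspaceI) (simp_all add: tangent_G2_iff assms add_right scaleR_right zero_right
      subspace_add[OF annih_subspace] subspace_scale[OF annih_subspace]
      subspace_0[OF annih_subspace])
qed

lemma riemannian_metric_g_form:
  assumes "\<forall>j\<le>6. l j > 0"
  shows "riemannian_metric G2 (left_translate_form (g_restr l))"
  unfolding riemannian_metric_def
proof (intro conjI ballI allI impI)
  interpret bounded_bilinear "(**) :: mat7 \<Rightarrow> mat7 \<Rightarrow> mat7" by (rule bounded_bilinear_matrix_mult)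
  interpret g: bounded_bilinear "g_form l" using bilinear_g_form bilinear_conv_bounded_bilinear
    by blast
  fix p v assume p: "p \<in> G2" and v: "v \<in> tangent_space G2 p"
  note m = metric_eq[OF p]
  note s = subspace_add[OF subspace_tangent[OF p]] subspace_scale[OF subspace_tangent[OF p]]
  show "left_translate_form (g_restr l) p v v > 0" if "v \<noteq> 0"
  proof -
    have "G2_inv p ** v \<noteq> 0"
    proof
      assume "G2_inv p ** v = 0"
      then have "p ** (G2_inv p ** v) = 0" by (simp add: zero_right)
      with that show False by (simp add: matrix_mul_assoc G2_inv_right p)
    qed
    with g_form_pos[OF assms] v show ?thesis by (simp add: m tangent_G2_iff p)
  qed
  fix w assume w: "w \<in> tangent_space G2 p"
  show "left_translate_form (g_restr l) p v w = left_translate_form (g_restr l) p w v"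
    by (simp add: m v w g_form_sym[of l "G2_inv p ** v"])
  show "left_translate_form (g_restr l) p (a *\<^sub>R v) w
      = a * left_translate_form (g_restr l) p v w" for a
    by (simp add: m s v w scaleR_right g.scaleR_left)
  show "left_translate_form (g_restr l) p (v + u) w =
      left_translate_form (g_restr l) p v w + left_translate_form (g_restr l) p u w"
    if "u \<in> tangent_space G2 p" for u
    by (simp add: m s v w that add_right g.add_left)
next
  fix V W assume *: "vector_field G2 V \<and> vector_field G2 W"
  then obtain U U' where U: "G2 \<subseteq> U" "smooth_on U V" "G2 \<subseteq> U'" "smooth_on U' W"
    by (auto simp: vector_field_def)
  have op: "open (U \<inter> U')" using U by (auto simp: smooth_on_def)
  \<comment> \<open>The bilinear form \<open>g_form\<close> is defined on all matrices, so the
    common domain of both fields carries a smooth extension.\<close>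
  have "smooth_on (U \<inter> U') (\<lambda>q. g_form l (left_triv V q) (left_triv W q))"
    by (rule smooth_on_bounded_bilinear[OF _ smooth_on_left_triv smooth_on_left_triv])
      (use bilinear_g_form U op in
        \<open>auto simp: bilinear_conv_bounded_bilinear intro: smooth_on_subset\<close>)
  moreover have "g_form l (left_triv V p) (left_triv W p)
      = left_translate_form (g_restr l) p (V p) (W p)"
    if "p \<in> G2" for p
    using * that by (simp add: metric_eq vector_field_def left_triv_def)
  ultimately show "smooth_function G2 (\<lambda>p. left_translate_form (g_restr l) p (V p) (W p))"
    unfolding smooth_function_def using U(1,3) by blast
qed

lemma left_invariant_metric_g_form: "left_invariant_metric G2 (left_translate_form (g_restr l))"
  unfolding left_invariant_metric_def
  by (simp add: metric_eq G2_mult tangent_translate G2_inv_translate)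

text \<open>The first conjunct justifies the real part in \<open>g_restr\<close>; the last makes
  dependence on seven parameters precise as injectivity of the parametrisation.\<close>

theorem proposition4p9:
  fixes l :: "nat \<Rightarrow> real"
  assumes "\<forall>j\<le>6. l j > 0"
  shows "(\<forall>X\<in>g2. \<forall>Y\<in>g2. g_hat l (complexify X) (complexify Y) = of_real (g_restr l X Y)) \<and>
    (\<forall>X\<in>g2. \<forall>Y\<in>g2. g_restr l (samelson X) (samelson Y) = g_restr l X Y) \<and>
    left_invariant_hermitian_structure G2
      (left_translate_endo samelson) (left_translate_form (g_restr l)) \<and>
    (\<forall>m. (\<forall>j\<le>6. m j > 0) \<and> (\<forall>X\<in>g2. \<forall>Y\<in>g2. g_restr m X Y = g_restr l X Y)
       \<longrightarrow> (\<forall>j\<le>6. m j = l j))"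
proof (intro conjI allI impI ballI)
  have g2: "g2 = annih" by (simp add: g2_def tangent_one_eq)
  show "g_hat l (complexify X) (complexify Y) = of_real (g_restr l X Y)"
      if "X \<in> g2" "Y \<in> g2" for X Y
    using that by (simp add: g2 g_hat_eq g_restr_eq_g_form)
  show "g_restr l (samelson X) (samelson Y) = g_restr l X Y" if "X \<in> g2" "Y \<in> g2" for X Y
    using that by (simp add: g2 samelson_eq_Jlin g_restr_eq_g_form Jlin_annih g_form_Jlin)
  have "left_translate_form (g_restr l) F (J_field F v) (J_field F w)
      = left_translate_form (g_restr l) F v w"
    if "F \<in> G2" "v \<in> tangent_space G2 F" "w \<in> tangent_space G2 F" for F v w
    using that
    by (simp add: metric_eq J_field_eq tangent_G2_mult Jlin_annih matrix_mul_assoc G2_inv_left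
        g_form_Jlin)
  then show "left_invariant_hermitian_structure G2 J_field (left_translate_form (g_restr l))"
    unfolding left_invariant_hermitian_structure_def
    using almost_complex_J_field integrable_J_field left_invariant_J_field
      riemannian_metric_g_form[OF assms] left_invariant_metric_g_form by blast
  show "m j = l j"
    if "(\<forall>j\<le>6. m j > 0) \<and> (\<forall>X\<in>g2. \<forall>Y\<in>g2. g_restr m X Y = g_restr l X Y)" "j \<le> 6" for m j
  proof (rule g_form_determines[OF _ that(2)])
    fix k :: nat assume "k \<in> {1..14}"
    then have k: "bas k \<in> annih" by (rule annih_bas)
    with that(1) have "g_restr m (bas k) (bas k) = g_restr l (bas k) (bas k)" by (simp add: g2)
    then show "g_form m (bas k) (bas k) = g_form l (bas k) (bas k)"
      by (simp add: g_restr_eq_g_form k)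
  qed
qed

end
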